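(* Let $n,m$ be positive integers, $d=n+m$, $c=\sqrt{2d(d-1)}$, and let $\Theta$ be a real $n\times m$ matrix with transpose ${}^t\Theta$. Let $\phi:\mathbb R_+\to\mathbb R_+$ be an arbitrary function such that $t^n\phi(t)^{m-1}\to+\infty$ as $t\to+\infty$. Let $\psi:\mathbb R_+\to\mathbb R_+$ be an invertible decreasing function, with inverse $\psi^-$, such that for all $t$ large enough one of the following two conditions holds: (i) $t\psi(t)$ is non-increasing and $\psi\big(\Delta_d t^n\phi(t)^{m-1}\big)\leq(c\Delta_d t)^{-1}$; (ii) $t\psi(t)$ is non-decreasing and $\psi^-\big(\Delta_d t^{n-1}\phi(t)^m\big)\leq(c\Delta_d\phi(t))^{-1}$. If $\Theta$ is uniformly $\psi$-approximable, then ${}^t\Theta$ is uniformly $\phi$-approximable.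
   Context: $\mathbb R_+$ denotes the positive reals and $|\cdot|_\infty$ the sup-norm. $\Delta_d=\frac{1}{2^{d-1}\sqrt d}\,\mathrm{vol}_{d-1}\{\mathbf x\in[-1,1]^d : \sum_{i=1}^d x_i=0\}$, where $\mathrm{vol}_{d-1}$ is $(d-1)$-dimensional Lebesgue measure. For $\psi:\mathbb R_+\to\mathbb R_+$, $\Theta$ is uniformly $\psi$-approximable if for every sufficiently large $t$ there exist $\mathbf x\in\mathbb Z^m$, $\mathbf y\in\mathbb Z^n$ with $0<|\mathbf x|_\infty\leq t$ and $|\Theta\mathbf x-\mathbf y|_\infty\leq\psi(t)$; ${}^t\Theta$ is uniformly $\phi$-approximable if for every sufficiently large $t$ there exist $\mathbf y\in\mathbb Z^n$, $\mathbf x\in\mathbb Z^m$ with $0<|\mathbf y|_\infty\leq t$ and $|{}^t\Theta\mathbf y-\mathbf x|_\infty\leq\phi(t)$. "Invertible" means bijective as a map $\mathbb R_+\to\mathbb R_+$. *)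

theory Defs
  imports "HOL-Analysis.Analysis"
begin

definition orthonormal_basis_of :: "'a::euclidean_space set \<Rightarrow> 'a set \<Rightarrow> bool" where
  "orthonormal_basis_of V B \<longleftrightarrow>
     pairwise orthogonal B \<and> (\<forall>b\<in>B. norm b = 1) \<and> span B = V"

(* Lebesgue measure of dimension (dim V) on a linear subspace V, as a Borel measure on the
   ambient space: lborel_eq with the standard basis replaced by an orthonormal basis of V.
   By rotation invariance of Lebesgue measure the choice of B is immaterial. *)
definition subspace_lborel :: "'a::euclidean_space set \<Rightarrow> 'a measure" where
  "subspace_lborel V =
     (let B = (SOME B. orthonormal_basis_of V B)
      in distr (\<Pi>\<^sub>M b\<in>B. lborel) borel (\<lambda>f. \<Sum>b\<in>B. f b *\<^sub>R b))"

lemma orthonormal_basis_of_SOME: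
  fixes V :: "'a::euclidean_space set"
  assumes "subspace V"
  shows "orthonormal_basis_of V (SOME B. orthonormal_basis_of V B)"
proof -
  obtain B where "pairwise orthogonal B" "\<And>b. b \<in> B \<Longrightarrow> norm b = 1" "span B = V"
    using orthonormal_basis_subspace[OF assms] by metis
  then have "orthonormal_basis_of V B"
    by (simp add: orthonormal_basis_of_def)
  then show ?thesis
    by (rule someI)
qed

definition sum_zero_hyperplane :: "(real ^ 'k) set" where
  "sum_zero_hyperplane = {x. (\<Sum>i\<in>UNIV. x $ i) = 0}"

(* The dimension d is CARD('k). *)
definition Delta :: "'k::finite itself \<Rightarrow> real" where
  "Delta _ =
     1 / (2 ^ (CARD('k) - 1) * sqrt (real CARD('k))) *
     measure (subspace_lborel (sum_zero_hyperplane :: (real ^ 'k) set))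
       {x. (\<forall>i. x $ i \<in> {-1..1}) \<and> (\<Sum>i\<in>UNIV. x $ i) = 0}"

definition integer_vector :: "real ^ 'k \<Rightarrow> bool" where
  "integer_vector x \<longleftrightarrow> (\<forall>i. x $ i \<in> \<int>)"

(* infnorm is the sup-norm. *)
definition uniformly_approximable :: "real ^ 'm ^ 'n \<Rightarrow> (real \<Rightarrow> real) \<Rightarrow> bool" where
  "uniformly_approximable \<Theta> \<psi> \<longleftrightarrow>
     (\<forall>\<^sub>F t in at_top. \<exists>(x :: real ^ 'm) (y :: real ^ 'n).
        integer_vector x \<and> integer_vector y \<and>
        0 < infnorm x \<and> infnorm x \<le> t \<and> infnorm (\<Theta> *v x - y) \<le> \<psi> t)"

end

theory Submission
  imports Defs
begin

text \<open>
  Fix a large \<open>t\<close> and put \<open>f = \<phi> t\<close>. The integer pairs \<open>(p, q)\<close> sought for the transposed system are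
  the points of a lattice of covolume \<open>1 / (t^n f^m)\<close> in the cube \<open>[-1,1]^d\<close>, and every integer pair
  \<open>(x, y)\<close> gives a vector \<open>w = (t (\<Theta> x - y), - f x)\<close> having integral inner products with this lattice.

  Blichfeldt's principle, applied to a stack of translates of a part of the half cube that is thin in
  direction \<open>w\<close>, yields a lattice point in the cube orthogonal to \<open>w\<close> as soon as the density of
  \<open>\<xi> \<bullet> w\<close> (with \<open>\<xi>\<close> uniform in the half cube) exceeds the covolume somewhere. By unimodality this density
  at 0 is at least \<open>\<Delta> / |w|\<close> in the sup-norm, with equality for \<open>w = (1, ..., 1)\<close>. If no single
  \<open>w\<close> is short enough, two consecutive approximations give independent \<open>w\<close>, \<open>w'\<close> with
  \<open>c |w| |w'| \<le> t^n f^m\<close>; here the conditions on \<open>\<psi>\<close> enter. The same principle then applies to the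
  planar density of \<open>(\<xi> \<bullet> w, \<xi> \<bullet> w')\<close>, except for \<open>d = 2\<close>, where a nonzero integral determinant of absolute
  value less than 1 gives a contradiction.
\<close>

text \<open>Both constants have a geometric origin. \<open>Delta\<close> is the density at 0 of the
  sum of the coordinates on the half cube: passing from [-1,1]^d to the half cube divides the volume
  of the central slice by 2^(d-1), and sqrt d is the norm of (1, ..., 1). The number c |w| |w'|
  bounds the area spanned by w and w': each of their d (d - 1) / 2 minors is at most 2 |w| |w'| in
  the sup-norm. For d = 2 the only minor is the determinant, and c = 2. The natural route would be
  Minkowski's theorem in the sublattice orthogonal to w. Blichfeldt's principle sees only that
  products with w are integers, so no covolume of a sublattice has to be computed; and since it
  speaks of differences, the density may be large at any point, not just at 0. Densities enter only
  through measures of thin slabs, at the price of a factor arbitrarily close to 1. The resulting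
  strict inequality in the case of one w is removed afterwards: only finitely many integer pairs
  compete.\<close>

section \<open>Linear forms on the cube\<close>

text \<open>The weight \<open>u\<close> is the indicator of \<open>[-1/2, 1/2]\<close> for integrals over the cube, and constantly 1
  for integrals over the whole space.\<close>

definition cube_integral ::
    "(real \<Rightarrow> ennreal) \<Rightarrow> 'i set \<Rightarrow> ('i \<Rightarrow> real \<Rightarrow> real) \<Rightarrow> (real \<Rightarrow> ennreal) \<Rightarrow> real \<Rightarrow> ennreal" where
  "cube_integral u I g F s =
     (\<integral>\<^sup>+x. (\<Prod>i\<in>I. u (x i)) * F (s + (\<Sum>i\<in>I. g i (x i))) \<partial>(\<Pi>\<^sub>M i\<in>I. lborel))"

lemma cube_integral_measurable [measurable]:
  assumes [measurable]: "u \<in> borel_measurable borel" "F \<in> borel_measurable borel"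
    "\<And>i. i \<in> I \<Longrightarrow> g i \<in> borel_measurable borel" and fin: "finite (I :: 'i set)"
  shows "cube_integral u I g F \<in> borel_measurable borel"
proof -
  interpret product_sigma_finite "\<lambda>_::'i. lborel :: real measure" ..
  interpret finite_product_sigma_finite "\<lambda>_::'i. lborel :: real measure" I
    by standard (rule fin)
  have "(\<lambda>s. \<integral>\<^sup>+x. (\<Prod>i\<in>I. u (x i)) * F (s + (\<Sum>i\<in>I. g i (x i))) \<partial>(\<Pi>\<^sub>M i\<in>I. lborel))
      \<in> borel_measurable borel"
    by measurable
  then show ?thesis
    by (simp add: cube_integral_def[abs_def])
qed

lemma cube_integral_empty [simp]: "cube_integral u {} g F s = F s"
proof -
  show ?thesis
    by (simp add: cube_integral_def PiM_empty nn_integral_count_space_finite)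
qed

lemma cube_integral_insert:
  assumes [measurable]: "u \<in> borel_measurable borel" "F \<in> borel_measurable borel"
    "\<And>i. i \<in> insert j I \<Longrightarrow> g i \<in> borel_measurable borel"
    and fin: "finite I" and j: "(j::'i) \<notin> I"
  shows "cube_integral u (insert j I) g F s =
    (\<integral>\<^sup>+t. u t * cube_integral u I g F (s + g j t) \<partial>lborel)"
proof -
  interpret product_sigma_finite "\<lambda>_::'i. lborel :: real measure" ..
  have gi: "g i \<in> borel_measurable borel" if "i \<in> I" for i
    using assms(3) that by auto
  note gi[measurable]
  have gj[measurable]: "g j \<in> borel_measurable borel" using assms(3) by auto
  have "cube_integral u (insert j I) g F s = 
     (\<integral>\<^sup>+ t. (\<integral>\<^sup>+ x. (\<Prod>i\<in>insert j I. u ((x(j := t)) i)) *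
          F (s + (\<Sum>i\<in>insert j I. g i ((x(j := t)) i))) \<partial>(\<Pi>\<^sub>M i\<in>I. lborel)) \<partial>lborel)"
    unfolding cube_integral_def
    by (rule product_nn_integral_insert_rev[OF fin j]) measurable
  also have "\<dots> = (\<integral>\<^sup>+ t. (\<integral>\<^sup>+ x. u t * ((\<Prod>i\<in>I. u (x i)) *
          F (s + g j t + (\<Sum>i\<in>I. g i (x i)))) \<partial>(\<Pi>\<^sub>M i\<in>I. lborel)) \<partial>lborel)"
  proof (intro nn_integral_cong)
    fix t x
    have 1: "(\<Prod>i\<in>I. u ((x(j := t)) i)) = (\<Prod>i\<in>I. u (x i))"
      and 2: "(\<Sum>i\<in>I. g i ((x(j := t)) i)) = (\<Sum>i\<in>I. g i (x i))"
      using j by (auto intro!: prod.cong sum.cong)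
    show "(\<Prod>i\<in>insert j I. u ((x(j := t)) i)) *
          F (s + (\<Sum>i\<in>insert j I. g i ((x(j := t)) i))) =
          u t * ((\<Prod>i\<in>I. u (x i)) * F (s + g j t + (\<Sum>i\<in>I. g i (x i))))"
      using fin j 1 2 by (simp add: algebra_simps)
  qed
  also have "\<dots> = (\<integral>\<^sup>+t. u t * cube_integral u I g F (s + g j t) \<partial>lborel)"
    unfolding cube_integral_def
    by (intro nn_integral_cong nn_integral_cmult) measurable
  finally show ?thesis .
qed

text \<open>Only the number of coordinates and their weights matter. This serves to compare
  \<open>(real ^ 'n) \<times> (real ^ 'm)\<close> with \<open>real ^ ('n + 'm)\<close>, and two
  orthonormal bases of the same space.\<close>

lemma cube_integral_reindex:
  assumes [measurable]: "u \<in> borel_measurable borel" "F \<in> borel_measurable borel"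
    and g: "\<And>i. i \<in> I \<Longrightarrow> g i \<in> borel_measurable borel"
    and fin: "finite J" and h: "bij_betw h J I"
  shows "cube_integral u I g F s = cube_integral u J (\<lambda>i. g (h i)) F s"
  using fin h g
proof (induction J arbitrary: I s rule: finite_induct)
  case empty
  then have "I = {}" by (simp add: bij_betw_def)
  then show ?case by simp
next
  case (insert j J)
  define I' where "I' = h ` J"
  have inj: "inj_on h (insert j J)" and I: "I = insert (h j) I'"
    using insert.prems by (auto simp: bij_betw_def I'_def)
  have nj: "h j \<notin> I'" using inj insert.hyps by (auto simp: I'_def inj_on_def)
  have bij: "bij_betw h J I'" using inj by (auto simp: I'_def bij_betw_def inj_on_def)
  have gI: "\<And>i. i \<in> insert (h j) I' \<Longrightarrow> g i \<in> borel_measurable borel"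
    using insert.prems(2) I by auto
  have gJ: "\<And>i. i \<in> insert j J \<Longrightarrow> g (h i) \<in> borel_measurable borel"
    using gI by (auto simp: I'_def)
  have finI: "finite I'" using insert.hyps by (simp add: I'_def)
  have "cube_integral u I' g F x = cube_integral u J (\<lambda>i. g (h i)) F x" for x
    using gI by (intro insert.IH[OF bij]) auto
  then show ?case
    unfolding I
    by (simp only: cube_integral_insert[OF assms(1,2) gI finI nj]
          cube_integral_insert[OF assms(1,2) gJ insert.hyps(1,2)])
qed

abbreviation unit_ind :: "real \<Rightarrow> ennreal" where
  "unit_ind \<equiv> indicator {-1/2..1/2}"

text \<open>A uniform variable on [-1/2, 1/2] has mean 0 and variance 1/12; the cross terms vanish,
  one coordinate at a time.\<close>

lemma cube_integral_square:
  assumes "finite I"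
  shows "cube_integral unit_ind I (\<lambda>i t. w i * t) (\<lambda>x. ennreal (x\<^sup>2)) s =
    ennreal (s\<^sup>2 + (\<Sum>i\<in>I. (w i)\<^sup>2) / 12)"
  using assms
proof (induction I arbitrary: s rule: finite_induct)
  case empty
  then show ?case by simp
next
  case (insert j I)
  define c where "c = (\<Sum>i\<in>I. (w i)\<^sup>2) / 12"
  have c: "c \<ge> 0" by (simp add: c_def sum_nonneg)
  let ?F = "\<lambda>t. s\<^sup>2 * t + s * w j * t^2 + (w j)\<^sup>2 * t ^ 3 / 3 + c * t"
  have "cube_integral unit_ind (insert j I) (\<lambda>i t. w i * t) (\<lambda>x. ennreal (x\<^sup>2)) s =
    (\<integral>\<^sup>+t. ennreal ((s + w j * t)\<^sup>2 + c) * indicator {-1/2..1/2} t \<partial>lborel)"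
    using insert.hyps by (subst cube_integral_insert) (auto simp: insert.IH[simplified] c_def mult.commute)
  also have "\<dots> = ?F (1/2) - ?F (-1/2)"
  proof (rule nn_integral_FTC_Icc)
    fix t :: real
    show "(?F has_real_derivative (s + w j * t)\<^sup>2 + c) (at t)"
      by (auto intro!: derivative_eq_intros simp: power2_eq_square algebra_simps)
    show "0 \<le> (s + w j * t)\<^sup>2 + c" using c by simp
  qed auto
  also have "?F (1/2) - ?F (-1/2) = s\<^sup>2 + (\<Sum>i\<in>insert j I. (w i)\<^sup>2) / 12"
    using insert.hyps by (simp add: c_def power3_eq_cube power2_eq_square field_simps)
  finally show ?case .
qed

section \<open>Unimodality and monotonicity in the weights\<close>

definition even_unimodal :: "(real \<Rightarrow> ennreal) \<Rightarrow> bool" where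
  "even_unimodal F \<longleftrightarrow> (\<forall>x y. \<bar>x\<bar> \<le> \<bar>y\<bar> \<longrightarrow> F y \<le> F x)"

text \<open>Averaging over a symmetric window keeps a function even and unimodal; this is the
  induction step that adds one coordinate of the cube. The sign of \<open>w\<close> is removed by
  reflecting the window (\<open>Gneg\<close>).\<close>

lemma even_unimodal_window:
  assumes g: "even_unimodal g" and [measurable]: "g \<in> borel_measurable borel"
  shows "even_unimodal (\<lambda>s. \<integral>\<^sup>+t. unit_ind t * g (s + w * t) \<partial>lborel)"
proof -
  let ?G = "\<lambda>w s. \<integral>\<^sup>+t. unit_ind t * g (s + w * t) \<partial>lborel"
  have refl: "(\<integral>\<^sup>+t. f t \<partial>lborel) = (\<integral>\<^sup>+t. f (c - t) \<partial>lborel)"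
    if [measurable]: "f \<in> borel_measurable borel" for f :: "real \<Rightarrow> ennreal" and c
    using nn_integral_real_affine[of f "-1" c] by simp
  have sym: "g (- x) = g x" for x
    using g unfolding even_unimodal_def by (metis abs_minus_cancel order.eq_iff)
  have Gneg: "?G w s = ?G (-w) s" for w s
    by (subst refl[where c = 0]) (auto intro!: nn_integral_cong simp: indicator_def)
  have Geven: "?G w (-s) = ?G w s" for w s
  proof -
    have "?G w (-s) = ?G (-w) s"
      by (intro nn_integral_cong) (metis (no_types, opaque_lifting) sym minus_add_distrib minus_minus minus_mult_left)
    then show ?thesis using Gneg by simp
  qed
  have main: "?G w s' \<le> ?G w s" if w: "w > 0" and s: "0 \<le> s" "s \<le> s'" for w s s'
  proof -
    \<comment> \<open>Replacing \<open>s\<close> by \<open>s'\<close> amounts to moving the window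
      by \<open>r\<close> under the same integrand, so the two values of \<open>?G\<close> are
      integrals of \<open>?f\<close> over \<open>B\<close> and over \<open>A\<close>.\<close>
    define r where "r = (s' - s) / w"
    have r: "r \<ge> 0" "s' = s + w * r" using w s by (auto simp: r_def)
    define A where "A = {-1/2..1/2::real}"
    define B where "B = {r-1/2..r+1/2}"
    let ?f = "\<lambda>t. g (s + w * t)"
    have [measurable]: "A \<in> sets borel" "B \<in> sets borel" by (auto simp: A_def B_def)
    have split: "(\<integral>\<^sup>+t. indicator C t * ?f t \<partial>lborel) =
        (\<integral>\<^sup>+t. indicator (C \<inter> D) t * ?f t \<partial>lborel) + (\<integral>\<^sup>+t. indicator (C - D) t * ?f t \<partial>lborel)"
      if [measurable]: "C \<in> sets borel" "D \<in> sets borel" for C D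
      by (subst nn_integral_add[symmetric]) (auto intro!: nn_integral_cong simp: indicator_def)
    have "?G w s' = (\<integral>\<^sup>+t. indicator B t * ?f t \<partial>lborel)"
      using nn_integral_real_affine[of "\<lambda>t. indicator B t * ?f t" 1 r]
      by (auto intro!: nn_integral_cong simp: r indicator_def B_def algebra_simps)
    also have "\<dots> = (\<integral>\<^sup>+t. indicator (B \<inter> A) t * ?f t \<partial>lborel) + (\<integral>\<^sup>+t. indicator (B - A) t * ?f t \<partial>lborel)"
      by (rule split) measurable
    \<comment> \<open>The reflection \<open>t \<mapsto> r - t\<close> maps \<open>B - A\<close> onto \<open>A - B\<close> and moves \<open>s + w t\<close> closer to 0.\<close>
    also have "(\<integral>\<^sup>+t. indicator (B - A) t * ?f t \<partial>lborel) \<le> (\<integral>\<^sup>+t. indicator (A - B) t * ?f t \<partial>lborel)"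
    proof -
      have "(\<integral>\<^sup>+t. indicator (A - B) t * ?f t \<partial>lborel) =
        (\<integral>\<^sup>+t. indicator (A - B) (r - t) * ?f (r - t) \<partial>lborel)"
        by (rule refl) measurable
      moreover have "indicator (B - A) t * ?f t \<le> indicator (A - B) (r - t) * ?f (r - t)" for t
      proof (cases "t \<in> B - A")
        case True
        then have t: "t > 1/2" "t \<le> r + 1/2" "t \<ge> r - 1/2" using r by (auto simp: A_def B_def)
        have "\<bar>r - t\<bar> \<le> t" using t r by auto
        then have "w * \<bar>r - t\<bar> \<le> w * t" using w by (intro mult_left_mono) auto
        then have "\<bar>w * (r - t)\<bar> \<le> w * t" using w by (simp add: abs_mult)
        then have "\<bar>s + w * (r - t)\<bar> \<le> \<bar>s + w * t\<bar>" using s by linarith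
        then have "?f t \<le> ?f (r - t)" using g by (simp add: even_unimodal_def)
        moreover have "r - t \<in> A - B" using t by (auto simp: A_def B_def)
        ultimately show ?thesis using True
          by (simp only: indicator_eq_1_iff[THEN iffD2] mult_1_left)
      qed (auto simp: indicator_def)
      ultimately show ?thesis by (auto intro!: nn_integral_mono)
    qed
    also have "(\<integral>\<^sup>+t. indicator (B \<inter> A) t * ?f t \<partial>lborel) + (\<integral>\<^sup>+t. indicator (A - B) t * ?f t \<partial>lborel) = ?G w s"
      using split[of A B] by (simp add: Int_commute A_def)
    finally show ?thesis by (simp add: add_left_mono)
  qed
  have main': "?G w s' \<le> ?G w s" if s: "0 \<le> s" "s \<le> s'" for s s'
  proof (cases w "0::real" rule: linorder_cases)
    case less
    then have "?G (-w) s' \<le> ?G (-w) s" using main[of "-w" s s'] s by linarith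
    then show ?thesis by (metis (no_types, lifting) Gneg)
  next
    case equal
    have "g s' \<le> g s" using g s by (simp add: even_unimodal_def)
    then show ?thesis using equal by (auto intro!: nn_integral_mono mult_left_mono)
  next
    case greater
    then show ?thesis using main s by blast
  qed
  have "?G w y \<le> ?G w x" if "\<bar>x\<bar> \<le> \<bar>y\<bar>" for x y
  proof -
    have "?G w y = ?G w \<bar>y\<bar>" "?G w x = ?G w \<bar>x\<bar>" using Geven by (auto simp: abs_if)
    then show ?thesis using main'[of "\<bar>x\<bar>" "\<bar>y\<bar>"] that by simp
  qed
  then show ?thesis by (auto simp: even_unimodal_def)
qed

lemma even_unimodal_cube_integral:
  assumes "finite I" and F: "even_unimodal F" and [measurable]: "F \<in> borel_measurable borel"
  shows "even_unimodal (cube_integral unit_ind I (\<lambda>i t. w i * t) F)"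
  using assms(1)
proof (induction I rule: finite_induct)
  case empty
  show ?case using F by (simp add: even_unimodal_def)
next
  case (insert j I)
  have "cube_integral unit_ind (insert j I) (\<lambda>i t. w i * t) F =
    (\<lambda>s. \<integral>\<^sup>+t. unit_ind t * cube_integral unit_ind I (\<lambda>i t. w i * t) F (s + w j * t) \<partial>lborel)"
    using insert.hyps by (intro ext cube_integral_insert) auto
  moreover have "cube_integral unit_ind I (\<lambda>i t. w i * t) F \<in> borel_measurable borel"
    using insert.hyps by measurable
  ultimately show ?case
    using even_unimodal_window[OF insert.IH] by simp
qed

text \<open>The weights are exchanged one at a time (\<open>?u J\<close> is \<open>w\<close> on
  \<open>J\<close> and \<open>v\<close> elsewhere). For a fixed value \<open>t\<close> of the
  exchanged coordinate, the integral over the others is even and unimodal, and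
  \<open>v j * t\<close> is closer to 0 than \<open>w j * t\<close>.\<close>

lemma cube_integral_antimono_weights:
  assumes fin: "finite I" and F: "even_unimodal F" and [measurable]: "F \<in> borel_measurable borel"
    and vw: "\<And>i. i \<in> I \<Longrightarrow> \<bar>v i\<bar> \<le> \<bar>w i\<bar>"
  shows "cube_integral unit_ind I (\<lambda>i t. w i * t) F 0 \<le> cube_integral unit_ind I (\<lambda>i t. v i * t) F 0"
proof -
  let ?u = "\<lambda>J i. if i \<in> J then w i else v i"
  have "cube_integral unit_ind I (\<lambda>i t. ?u J i * t) F 0 \<le> cube_integral unit_ind I (\<lambda>i t. v i * t) F 0"
    if "J \<subseteq> I" for J
    using finite_subset[OF that fin] that
  proof (induction J rule: finite_induct)
    case (insert j J)
    define K where "K = I - {j}"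
    have K: "finite K" "j \<notin> K" "I = insert j K" using fin insert.prems by (auto simp: K_def)
    have eq: "cube_integral unit_ind K (\<lambda>i t. ?u (insert j J) i * t) F =
        cube_integral unit_ind K (\<lambda>i t. ?u J i * t) F"
      unfolding cube_integral_def using K by (auto intro!: ext nn_integral_cong sum.cong arg_cong2[where f="(*)"] arg_cong[where f=F])
    have uni: "even_unimodal (cube_integral unit_ind K (\<lambda>i t. ?u J i * t) F)"
      by (rule even_unimodal_cube_integral[OF K(1) F]) simp
    have "cube_integral unit_ind I (\<lambda>i t. ?u (insert j J) i * t) F 0 =
      (\<integral>\<^sup>+t. unit_ind t * cube_integral unit_ind K (\<lambda>i t. ?u (insert j J) i * t) F (0 + w j * t) \<partial>lborel)"
      unfolding K(3) by (subst cube_integral_insert) (use K in auto)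
    also have "\<dots> \<le> (\<integral>\<^sup>+t. unit_ind t * cube_integral unit_ind K (\<lambda>i t. ?u J i * t) F (0 + v j * t) \<partial>lborel)"
      unfolding eq
    proof (intro nn_integral_mono mult_left_mono)
      fix t :: real
      have "\<bar>v j * t\<bar> \<le> \<bar>w j * t\<bar>"
        using vw[of j] K by (auto simp: abs_mult intro!: mult_right_mono)
      then show "cube_integral unit_ind K (\<lambda>i t. ?u J i * t) F (0 + w j * t) \<le>
          cube_integral unit_ind K (\<lambda>i t. ?u J i * t) F (0 + v j * t)"
        using uni by (simp add: even_unimodal_def)
    qed simp
    also have "\<dots> = cube_integral unit_ind I (\<lambda>i t. ?u J i * t) F 0"
      unfolding K(3) by (subst cube_integral_insert) (use K insert.hyps in auto)
    finally show ?case using insert by auto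
  qed simp
  from this[of I] show ?thesis
    by (auto simp: cube_integral_def cong: sum.cong)
qed

text \<open>Differences of its points lie in [-1,1]^d, where the integer solutions are sought. Its
  volume is 1, so integrals over it are expectations.\<close>

definition half_cube :: "'a::euclidean_space set" where
  "half_cube = {x. \<forall>b\<in>Basis. \<bar>x \<bullet> b\<bar> \<le> 1/2}"

lemma half_cube_borel [measurable]: "half_cube \<in> sets borel"
  unfolding half_cube_def by measurable

lemma nn_integral_half_cube:
  fixes w :: "'a::euclidean_space"
  assumes [measurable]: "F \<in> borel_measurable borel"
  shows "(\<integral>\<^sup>+\<xi>. indicator half_cube \<xi> * F (s + \<xi> \<bullet> w) \<partial>lborel) =
    cube_integral unit_ind Basis (\<lambda>b t. (w \<bullet> b) * t) F s"
proof -
  have "(\<integral>\<^sup>+\<xi>. indicator half_cube \<xi> * F (s + \<xi> \<bullet> w) \<partial>lborel) =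
    (\<integral>\<^sup>+f. indicator half_cube (\<Sum>b\<in>Basis. f b *\<^sub>R b :: 'a) * F (s + (\<Sum>b\<in>Basis. f b *\<^sub>R b) \<bullet> w)
      \<partial>(\<Pi>\<^sub>M b\<in>(Basis::'a set). lborel))"
    by (subst lborel_eq, subst nn_integral_distr) auto
  also have "\<dots> = cube_integral unit_ind Basis (\<lambda>b t. (w \<bullet> b) * t) F s"
    unfolding cube_integral_def
  proof (intro nn_integral_cong)
    fix f :: "'a \<Rightarrow> real"
    have "indicator half_cube (\<Sum>b\<in>Basis. f b *\<^sub>R b :: 'a) = (\<Prod>b\<in>(Basis::'a set). unit_ind (f b))"
    proof (cases "\<forall>b\<in>(Basis::'a set). \<bar>f b\<bar> \<le> 1/2")
      case True
      then have "(\<Sum>b\<in>Basis. f b *\<^sub>R b :: 'a) \<in> half_cube"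
        by (auto simp: half_cube_def inner_sum_left_Basis)
      moreover have "(\<Prod>b\<in>(Basis::'a set). unit_ind (f b)) = 1"
        using True by (intro prod.neutral) (auto simp: indicator_def abs_le_iff)
      ultimately show ?thesis by simp
    next
      case False
      then obtain b :: 'a where b: "b \<in> Basis" "\<not> \<bar>f b\<bar> \<le> 1/2" by blast
      then have "(\<Sum>b\<in>Basis. f b *\<^sub>R b :: 'a) \<notin> half_cube"
        by (auto simp: half_cube_def inner_sum_left_Basis)
      moreover have "(\<Prod>b\<in>(Basis::'a set). unit_ind (f b)) = 0"
        using b by (auto intro!: prod_zero bexI[of _ b] simp: indicator_def)
      ultimately show ?thesis by simp
    qed
    moreover have "(\<Sum>b\<in>Basis. f b *\<^sub>R b) \<bullet> w = (\<Sum>b\<in>Basis. (w \<bullet> b) * f b)"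
      by (simp add: inner_sum_left inner_commute[of w] mult.commute)
    ultimately show "indicator half_cube (\<Sum>b\<in>Basis. f b *\<^sub>R b :: 'a) * F (s + (\<Sum>b\<in>Basis. f b *\<^sub>R b) \<bullet> w) =
       (\<Prod>b\<in>(Basis::'a set). unit_ind (f b)) * F (s + (\<Sum>b\<in>Basis. (w \<bullet> b) * f b))"
      by simp
  qed
  finally show ?thesis .
qed

lemma emeasure_half_cube: "emeasure lborel (half_cube :: 'a::euclidean_space set) = 1"
proof -
  have "half_cube = cbox (- (1/2) *\<^sub>R One) ((1/2) *\<^sub>R One :: 'a)"
    unfolding half_cube_def cbox_def
    by (intro Collect_cong ball_cong) (auto simp: abs_le_iff)
  then have "emeasure lborel (half_cube :: 'a set) =
      emeasure lborel (cbox (- (1/2) *\<^sub>R One) ((1/2) *\<^sub>R One :: 'a))" by simp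
  also have "\<dots> = 1"
    by (subst emeasure_lborel_cbox_eq) (auto simp: inner_diff_left inner_add_left intro!: prod.neutral)
  finally show ?thesis .
qed

lemma nn_integral_half_cube_square:
  fixes w :: "'a::euclidean_space"
  shows "(\<integral>\<^sup>+\<xi>. indicator half_cube \<xi> * ennreal ((\<xi> \<bullet> w)\<^sup>2) \<partial>lborel) = ennreal ((norm w)\<^sup>2 / 12)"
proof -
  have "(\<integral>\<^sup>+\<xi>. indicator half_cube \<xi> * ennreal ((\<xi> \<bullet> w)\<^sup>2) \<partial>lborel) =
     ennreal ((\<Sum>b\<in>Basis. (w \<bullet> b)\<^sup>2) / 12)"
    using nn_integral_half_cube[of "\<lambda>x. ennreal (x\<^sup>2)" 0 w] cube_integral_square[of "Basis :: 'a set" "\<lambda>b. w \<bullet> b" 0]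
    by simp
  also have "(\<Sum>b\<in>Basis. (w \<bullet> b)\<^sup>2) = (norm w)\<^sup>2"
    unfolding power2_norm_eq_inner by (subst euclidean_inner) (simp add: power2_eq_square)
  finally show ?thesis .
qed

text \<open>The weights of \<open>One\<close> dominate those of \<open>w\<close>, so
  \<open>One\<close> is the extremal direction behind \<open>Delta\<close>. Two spaces of equal
  dimension occur because \<open>w\<close> lives in a product, while \<open>Delta\<close> refers to
  a single \<open>real ^ 'k\<close>.\<close>

lemma slab_measure_antimono:
  fixes w :: "'a::euclidean_space"
  assumes dim: "DIM('a) = DIM('b::euclidean_space)" and w: "\<And>b. b \<in> Basis \<Longrightarrow> \<bar>w \<bullet> b\<bar> \<le> 1"
  shows "emeasure lborel {\<xi>\<in>half_cube. \<bar>\<xi> \<bullet> (One::'b)\<bar> < \<delta>} \<le> emeasure lborel {\<xi>\<in>half_cube. \<bar>\<xi> \<bullet> w\<bar> < \<delta>}"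
proof -
  let ?F = "indicator {- \<delta><..<\<delta>} :: real \<Rightarrow> ennreal"
  have F: "even_unimodal ?F" by (auto simp: even_unimodal_def indicator_def)
  have slab: "emeasure lborel {\<xi>\<in>half_cube. \<bar>\<xi> \<bullet> v\<bar> < \<delta>} =
      cube_integral unit_ind Basis (\<lambda>b t. (v \<bullet> b) * t) ?F 0" for v :: "'c::euclidean_space"
  proof -
    have "emeasure lborel {\<xi>\<in>half_cube. \<bar>\<xi> \<bullet> v\<bar> < \<delta>} =
        (\<integral>\<^sup>+\<xi>. indicator {\<xi>\<in>half_cube. \<bar>\<xi> \<bullet> v\<bar> < \<delta>} \<xi> \<partial>lborel)"
      by (rule nn_integral_indicator[symmetric]) measurable
    also have "\<dots> = (\<integral>\<^sup>+\<xi>. indicator half_cube \<xi> * ?F (0 + \<xi> \<bullet> v) \<partial>lborel)"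
      by (intro nn_integral_cong) (auto simp: indicator_def)
    finally show ?thesis by (simp only: nn_integral_half_cube[OF borel_measurable_indicator[OF borel_open[OF open_greaterThanLessThan]]])
  qed
  obtain h where h: "bij_betw h (Basis :: 'a set) (Basis :: 'b set)"
    using dim finite_same_card_bij[OF finite_Basis finite_Basis] by metis
  have "cube_integral unit_ind (Basis::'b set) (\<lambda>b t. ((One::'b) \<bullet> b) * t) ?F 0 =
     cube_integral unit_ind (Basis::'a set) (\<lambda>b t. ((One::'b) \<bullet> h b) * t) ?F 0"
    by (rule cube_integral_reindex[OF _ _ _ _ h]) auto
  also have "\<dots> \<le> cube_integral unit_ind Basis (\<lambda>b t. (w \<bullet> b) * t) ?F 0"
  proof (rule cube_integral_antimono_weights[OF _ F])
    fix b :: 'a assume b: "b \<in> Basis"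
    then have "h b \<in> Basis" using h by (auto simp: bij_betw_def)
    then show "\<bar>w \<bullet> b\<bar> \<le> \<bar>(One::'b) \<bullet> h b\<bar>" using w[OF b] by simp
  qed auto
  finally show ?thesis by (simp add: slab)
qed

section \<open>Lebesgue measure in orthonormal coordinates\<close>

text \<open>Uniqueness of Haar measure, cross-multiplied to avoid division: integrate
  \<open>indicator A x * indicator C (y + x)\<close> in both orders, translating the inner variable
  each time. The symmetry of \<open>A\<close> absorbs a sign.\<close>

lemma translation_invariant_proportional:
  fixes \<mu> \<nu> :: "'a::euclidean_space measure"
  assumes "sigma_finite_measure \<mu>" "sigma_finite_measure \<nu>"
    and sets: "sets \<mu> = sets borel" "sets \<nu> = sets borel"
    and inv: "\<And>a. distr \<mu> borel (\<lambda>x. x + a) = \<mu>" "\<And>a. distr \<nu> borel (\<lambda>x. x + a) = \<nu>"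
    and A: "A \<in> sets borel" "\<And>x. - x \<in> A \<longleftrightarrow> x \<in> A" and C: "C \<in> sets borel"
  shows "emeasure \<mu> A * emeasure \<nu> C = emeasure \<mu> C * emeasure \<nu> A"
proof -
  interpret M: sigma_finite_measure \<mu> by fact
  interpret N: sigma_finite_measure \<nu> by fact
  interpret pair_sigma_finite \<nu> \<mu> ..
  have [measurable_cong]: "sets \<mu> = sets borel" "sets \<nu> = sets borel" by fact+
  have [measurable]: "A \<in> sets borel" "C \<in> sets borel" by fact+
  have shift: "(\<integral>\<^sup>+x. f (x + a) \<partial>\<mu>) = (\<integral>\<^sup>+x. f x \<partial>\<mu>)" "(\<integral>\<^sup>+x. f (x + a) \<partial>\<nu>) = (\<integral>\<^sup>+x. f x \<partial>\<nu>)"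
    if [measurable]: "f \<in> borel_measurable borel" for f :: "'a \<Rightarrow> ennreal" and a
    by (subst (2) inv(1)[of a, symmetric] inv(2)[of a, symmetric], subst nn_integral_distr; simp)+
  have "emeasure \<mu> A * emeasure \<nu> C = (\<integral>\<^sup>+x. indicator A x * emeasure \<nu> C \<partial>\<mu>)"
    by (subst nn_integral_multc) auto
  also have "\<dots> = (\<integral>\<^sup>+x. indicator A x * (\<integral>\<^sup>+y. indicator C (y + x) \<partial>\<nu>) \<partial>\<mu>)"
    by (subst shift(2)) auto
  also have "\<dots> = (\<integral>\<^sup>+x. (\<integral>\<^sup>+y. indicator A x * indicator C (y + x) \<partial>\<nu>) \<partial>\<mu>)"
    by (subst nn_integral_cmult) auto
  also have "\<dots> = (\<integral>\<^sup>+y. (\<integral>\<^sup>+x. indicator A x * indicator C (y + x) \<partial>\<mu>) \<partial>\<nu>)"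
    by (rule Fubini') measurable
  also have "\<dots> = (\<integral>\<^sup>+y. (\<integral>\<^sup>+x. indicator A (x + (- y)) * indicator C (y + (x + (- y))) \<partial>\<mu>) \<partial>\<nu>)"
  proof (rule nn_integral_cong)
    fix y
    show "(\<integral>\<^sup>+x. indicator A x * indicator C (y + x) \<partial>\<mu>) =
      (\<integral>\<^sup>+x. indicator A (x + (- y)) * indicator C (y + (x + (- y))) \<partial>\<mu>)"
      by (rule shift(1)[symmetric]) measurable
  qed
  also have "\<dots> = (\<integral>\<^sup>+y. (\<integral>\<^sup>+x. indicator A (y + (- x)) * indicator C x \<partial>\<mu>) \<partial>\<nu>)"
    using A(2)[of "x - y" for x y]
    by (intro nn_integral_cong) (auto simp: indicator_def minus_diff_eq)
  also have "\<dots> = (\<integral>\<^sup>+x. (\<integral>\<^sup>+y. indicator A (y + (- x)) * indicator C x \<partial>\<nu>) \<partial>\<mu>)"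
    by (rule Fubini'[symmetric]) measurable
  also have "\<dots> = (\<integral>\<^sup>+x. (\<integral>\<^sup>+y. indicator A (y + (- x)) \<partial>\<nu>) * indicator C x \<partial>\<mu>)"
    by (intro nn_integral_cong nn_integral_multc) measurable
  also have "\<dots> = (\<integral>\<^sup>+x. emeasure \<nu> A * indicator C x \<partial>\<mu>)"
    by (subst shift(2)) auto
  also have "\<dots> = emeasure \<mu> C * emeasure \<nu> A"
    by (subst nn_integral_cmult) (auto simp: mult.commute)
  finally show ?thesis .
qed

lemma distr_PiM_lborel_shift:
  assumes fin: "finite (B :: 'i set)"
  shows "distr (\<Pi>\<^sub>M b\<in>B. lborel) (\<Pi>\<^sub>M b\<in>B. lborel) (\<lambda>f. \<lambda>b\<in>B. f b + a b) = (\<Pi>\<^sub>M b\<in>B. lborel :: real measure)"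
proof -
  interpret product_sigma_finite "\<lambda>_::'i. lborel :: real measure" ..
  show ?thesis
  proof (rule PiM_eqI[OF fin])
    fix A :: "'i \<Rightarrow> real set" assume A: "\<And>i. i \<in> B \<Longrightarrow> A i \<in> sets lborel"
    let ?A = "\<lambda>b. (\<lambda>x. a b + x) -` A b"
    have A': "?A b \<in> sets lborel" if "b \<in> B" for b
      using measurable_sets_borel[of "\<lambda>x. a b + x" borel "A b"] A[OF that] by simp
    have "emeasure (distr (\<Pi>\<^sub>M b\<in>B. lborel) (\<Pi>\<^sub>M b\<in>B. lborel) (\<lambda>f. \<lambda>b\<in>B. f b + a b)) (Pi\<^sub>E B A) =
       emeasure (\<Pi>\<^sub>M b\<in>B. lborel) (Pi\<^sub>E B ?A)"
      using A fin
      by (subst emeasure_distr)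
         (auto intro!: arg_cong2[where f=emeasure] sets_PiM_I_finite simp: space_PiM PiE_iff extensional_def add.commute)
    also have "\<dots> = (\<Prod>b\<in>B. emeasure lborel (?A b))"
      using A' fin by (intro emeasure_PiM) auto
    also have "\<dots> = (\<Prod>b\<in>B. emeasure lborel (A b))"
    proof (intro prod.cong refl)
      fix b assume "b \<in> B"
      have "emeasure lborel (A b) = emeasure (distr lborel borel ((+) (a b))) (A b)"
        by (simp add: lborel_distr_plus)
      also have "\<dots> = emeasure lborel (?A b)"
        using A[OF \<open>b \<in> B\<close>] by (subst emeasure_distr) auto
      finally show "emeasure lborel (?A b) = emeasure lborel (A b)" by simp
    qed
    finally show "emeasure (distr (\<Pi>\<^sub>M b\<in>B. lborel) (\<Pi>\<^sub>M b\<in>B. lborel) (\<lambda>f. \<lambda>b\<in>B. f b + a b)) (Pi\<^sub>E B A) =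
       (\<Prod>i\<in>B. emeasure lborel (A i))" .
  qed simp
qed

lemma orthonormal_expansion:
  fixes B :: "'a::euclidean_space set"
  assumes B: "orthonormal_basis_of UNIV B"
  shows "finite B" "card B = DIM('a)"
    and "(\<Sum>b\<in>B. f b *\<^sub>R b) \<bullet> (\<Sum>b\<in>B. g b *\<^sub>R b) = (\<Sum>b\<in>B. f b * g b)"
    and "(\<Sum>b\<in>B. (x \<bullet> b) *\<^sub>R b) = x"
    and "c \<in> B \<Longrightarrow> (\<Sum>b\<in>B. f b *\<^sub>R b) \<bullet> c = f c"
proof -
  have o: "pairwise orthogonal B" and n: "\<And>b. b \<in> B \<Longrightarrow> norm b = 1" and s: "span B = UNIV"
    using B by (auto simp: orthonormal_basis_of_def)
  have "0 \<notin> B" using n by force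
  then have ind: "independent B" using o by (simp add: pairwise_orthogonal_independent)
  then show fin: "finite B" by (rule independent_imp_finite)
  show "card B = DIM('a)" using ind s
    by (metis dim_UNIV dim_eq_card_independent dim_span)
  have bb: "b \<bullet> c = (if b = c then 1 else 0)" if "b \<in> B" "c \<in> B" for b c
    using o n that by (auto simp: pairwise_def orthogonal_def norm_eq_1)
  show c: "(\<Sum>b\<in>B. f b *\<^sub>R b) \<bullet> c = f c" if "c \<in> B" for c f
    using that fin by (simp add: inner_sum_left bb if_distrib cong: if_cong sum.cong)
  show "(\<Sum>b\<in>B. f b *\<^sub>R b) \<bullet> (\<Sum>b\<in>B. g b *\<^sub>R b) = (\<Sum>b\<in>B. f b * g b)"
    by (simp add: inner_sum_right c mult.commute cong: sum.cong)
  show "(\<Sum>b\<in>B. (x \<bullet> b) *\<^sub>R b) = x"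
    using o n s fin by (intro orthonormal_basis_expand) auto
qed

text \<open>Rotation invariance of Lebesgue measure. The left side is translation invariant, hence
  proportional to \<open>lborel\<close>; the factor is 1 because in any orthonormal coordinates the
  unit ball is the set where the sum of squares is below 1.\<close>

lemma lborel_eq_distr_orthonormal:
  fixes B :: "'a::euclidean_space set"
  assumes B: "orthonormal_basis_of UNIV B"
  shows "distr (\<Pi>\<^sub>M b\<in>B. lborel) borel (\<lambda>f. \<Sum>b\<in>B. f b *\<^sub>R b) = (lborel :: 'a measure)"
proof -
  note fin = orthonormal_expansion(1)[OF B] and e = orthonormal_expansion[OF B]
  have UB: "orthonormal_basis_of UNIV (Basis :: 'a set)"
    by (auto simp: orthonormal_basis_of_def pairwise_def orthogonal_def inner_Basis)
  define N where "N B = distr (\<Pi>\<^sub>M b\<in>B. lborel) borel (\<lambda>f. \<Sum>b\<in>B. f b *\<^sub>R b)" for B :: "'a set"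
  interpret product_sigma_finite "\<lambda>_::'a. lborel :: real measure" ..
  have lb: "lborel = N Basis" unfolding N_def by (rule lborel_eq)
  have sets_N: "sets (N B) = sets borel" by (simp add: N_def)
  have ball_N: "emeasure (N B) {x. norm x < 1} =
      cube_integral (\<lambda>_. 1) B (\<lambda>_ t. t\<^sup>2) (indicator {..<1}) 0"
    if B: "orthonormal_basis_of UNIV B" for B :: "'a set"
  proof -
    have fin: "finite B" using orthonormal_expansion(1)[OF B] .
    have "emeasure (N B) {x. norm x < 1} =
       (\<integral>\<^sup>+x. indicator {x. norm x < 1} x \<partial>N B)"
      by (rule nn_integral_indicator[symmetric]) (simp add: N_def)
    also have "\<dots> = (\<integral>\<^sup>+f. indicator {x. norm x < 1} (\<Sum>b\<in>B. f b *\<^sub>R b) \<partial>(\<Pi>\<^sub>M b\<in>B. lborel))"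
      unfolding N_def by (rule nn_integral_distr) auto
    also have "\<dots> = cube_integral (\<lambda>_. 1) B (\<lambda>_ t. t\<^sup>2) (indicator {..<1}) 0"
      unfolding cube_integral_def
    proof (intro nn_integral_cong)
      fix f :: "'a \<Rightarrow> real"
      have "(norm (\<Sum>b\<in>B. f b *\<^sub>R b))\<^sup>2 = (\<Sum>b\<in>B. (f b)\<^sup>2)"
        unfolding power2_norm_eq_inner orthonormal_expansion(3)[OF B] by (simp add: power2_eq_square)
      then have "norm (\<Sum>b\<in>B. f b *\<^sub>R b) < 1 \<longleftrightarrow> (\<Sum>b\<in>B. (f b)\<^sup>2) < 1"
        using abs_square_less_1[of "norm (\<Sum>b\<in>B. f b *\<^sub>R b)"] by simp
      then show "indicator {x. norm x < 1} (\<Sum>b\<in>B. f b *\<^sub>R b) =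
         (\<Prod>i\<in>B. 1) * (indicator {..<1} (0 + (\<Sum>i\<in>B. (f i)\<^sup>2)) :: ennreal)"
        by (simp add: indicator_def)
    qed
    finally show ?thesis .
  qed
  obtain h where h: "bij_betw h (Basis :: 'a set) B"
    using e(1,2) finite_same_card_bij[OF finite_Basis] by metis
  have ball_eq: "emeasure (N B) {x. norm x < 1} = emeasure lborel {x::'a. norm x < 1}"
    unfolding lb ball_N[OF B] ball_N[OF UB]
    by (rule cube_integral_reindex[OF _ _ _ _ h]) auto
  have ball: "{x::'a. norm x < 1} = ball 0 1" by auto
  have ball_fin: "emeasure lborel {x::'a. norm x < 1} < \<infinity>"
    unfolding ball by (intro emeasure_bounded_finite) auto
  have ball_pos: "emeasure lborel {x::'a. norm x < 1} \<noteq> 0"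
    unfolding ball by (metis content_ball_pos[of 1] measure_def enn2real_0 less_irrefl zero_less_one)
  have sf: "sigma_finite_measure (N B)"
  proof
    show "\<exists>A. countable A \<and> A \<subseteq> sets (N B) \<and> \<Union> A = space (N B) \<and> (\<forall>a\<in>A. emeasure (N B) a \<noteq> \<infinity>)"
    proof (intro exI[of _ "range (\<lambda>n::nat. cball 0 (real n))"] conjI ballI)
      show "range (\<lambda>n. cball 0 (real n)) \<subseteq> sets (N B)" by (auto simp: N_def)
      show "(\<Union>n. cball 0 (real n)) = space (N B)"
        by (auto simp: N_def real_arch_simple)
      fix a :: "'a set" assume "a \<in> range (\<lambda>n. cball 0 (real n))"
      then obtain n where a: "a = cball 0 (real n)" by auto
      have "emeasure (N B) a = emeasure (\<Pi>\<^sub>M b\<in>B. lborel)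
          ((\<lambda>f. \<Sum>b\<in>B. f b *\<^sub>R b) -` a \<inter> space (\<Pi>\<^sub>M b\<in>B. lborel))"
        unfolding N_def a by (rule emeasure_distr) auto
      also have "\<dots> \<le> emeasure (\<Pi>\<^sub>M b\<in>B. lborel) (Pi\<^sub>E B (\<lambda>_. {- real n..real n}))"
      proof (rule emeasure_mono)
        show "(\<lambda>f. \<Sum>b\<in>B. f b *\<^sub>R b) -` a \<inter> space (\<Pi>\<^sub>M b\<in>B. lborel) \<subseteq> Pi\<^sub>E B (\<lambda>_. {- real n..real n})"
        proof
          fix f assume f: "f \<in> (\<lambda>f. \<Sum>b\<in>B. f b *\<^sub>R b) -` a \<inter> space (\<Pi>\<^sub>M b\<in>B. lborel)"
          have "\<bar>f b\<bar> \<le> real n" if "b \<in> B" for b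
          proof -
            have "\<bar>f b\<bar> = \<bar>(\<Sum>b\<in>B. f b *\<^sub>R b) \<bullet> b\<bar>" using e(5)[OF that] by simp
            also have "\<dots> \<le> norm (\<Sum>b\<in>B. f b *\<^sub>R b) * norm b" by (rule Cauchy_Schwarz_ineq2)
            also have "norm b = 1" using B that by (auto simp: orthonormal_basis_of_def)
            finally show ?thesis using f a by auto
          qed
          then show "f \<in> Pi\<^sub>E B (\<lambda>_. {- real n..real n})"
            using f by (auto simp: space_PiM PiE_iff abs_le_iff minus_le_iff)
        qed
        show "Pi\<^sub>E B (\<lambda>_. {- real n..real n}) \<in> sets (\<Pi>\<^sub>M b\<in>B. lborel)"
          using fin by (intro sets_PiM_I_finite) auto
      qed
      also have "\<dots> = (\<Prod>b\<in>B. emeasure lborel {- real n..real n})"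
        using fin by (intro emeasure_PiM) auto
      also have "\<dots> < \<infinity>" by (simp add: ennreal_power)
      finally show "emeasure (N B) a \<noteq> \<infinity>" by simp
    qed auto
  qed
  have inv: "distr (N B) borel (\<lambda>x. x + a) = N B" for a
  proof -
    let ?S = "\<lambda>f. \<Sum>b\<in>B. f b *\<^sub>R b" and ?P = "\<Pi>\<^sub>M b\<in>B. lborel :: real measure"
      and ?T = "\<lambda>f. \<lambda>b\<in>B. f b + a \<bullet> b"
    have S[measurable]: "?S \<in> ?P \<rightarrow>\<^sub>M borel" by measurable
    have T[measurable]: "?T \<in> ?P \<rightarrow>\<^sub>M ?P" by measurable
    have "N B = distr (distr ?P ?P ?T) borel ?S"
      unfolding N_def by (simp add: distr_PiM_lborel_shift[OF fin])
    also have "\<dots> = distr ?P borel (?S \<circ> ?T)" by (rule distr_distr[OF S T])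
    also have "\<dots> = distr ?P borel ((\<lambda>x. x + a) \<circ> ?S)"
    proof (rule distr_cong)
      fix f
      have "(?S \<circ> ?T) f = (\<Sum>b\<in>B. f b *\<^sub>R b) + (\<Sum>b\<in>B. (a \<bullet> b) *\<^sub>R b)"
        by (simp add: scaleR_add_left sum.distrib[symmetric])
      then show "(?S \<circ> ?T) f = ((\<lambda>x. x + a) \<circ> ?S) f" by (simp add: e(4))
    qed auto
    also have "\<dots> = distr (N B) borel (\<lambda>x. x + a)"
      unfolding N_def by (rule distr_distr[symmetric]) auto
    finally show ?thesis by simp
  qed
  have inv': "distr (lborel :: 'a measure) borel (\<lambda>x. x + a) = lborel" for a
  proof -
    have "(\<lambda>x. x + a) = (+) a" by (auto simp: add.commute)
    then show ?thesis using lborel_distr_plus[of a] by simp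
  qed
  have "N B = lborel"
  proof (rule measure_eqI)
    fix C assume "C \<in> sets (N B)"
    then have C: "C \<in> sets borel" using sets_N by simp
    have "emeasure lborel {x::'a. norm x < 1} * emeasure (N B) C =
       emeasure lborel C * emeasure lborel {x::'a. norm x < 1}"
      using translation_invariant_proportional[OF sigma_finite_lborel sf _ sets_N inv' inv _ _ C, of "{x. norm x < 1}"]
      by (simp add: ball_eq)
    then show "emeasure (N B) C = emeasure lborel C"
      using ball_fin ball_pos
      by (metis ennreal_mult_cancel_left infinity_ennreal_def less_irrefl mult.commute)
  qed (simp add: sets_N)
  then show ?thesis by (simp add: N_def)
qed

section \<open>Thin slabs and the constant \<open>\<Delta>\<close>\<close>

lemma emeasure_lborel_scale:
  fixes A :: "'a::euclidean_space set"
  assumes c: "c > 0" and A[measurable]: "A \<in> sets borel"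
  shows "emeasure lborel A = ennreal (c ^ DIM('a)) * emeasure lborel {x. c *\<^sub>R x \<in> A}"
proof -
  have "emeasure lborel A = emeasure (density (distr lborel borel (\<lambda>x. 0 + c *\<^sub>R x)) (\<lambda>_. \<bar>c\<bar> ^ DIM('a))) A"
    using lborel_affine[of c "0::'a"] c by simp
  also have "\<dots> = (\<integral>\<^sup>+x. ennreal (c ^ DIM('a)) * indicator A (c *\<^sub>R x) \<partial>lborel)"
    using c by (subst emeasure_density) (auto simp: nn_integral_distr)
  also have "\<dots> = ennreal (c ^ DIM('a)) * (\<integral>\<^sup>+x. indicator {x. c *\<^sub>R x \<in> A} x \<partial>lborel)"
    by (subst nn_integral_cmult[symmetric])
       (auto simp: indicator_def intro!: nn_integral_cong)
  also have "(\<integral>\<^sup>+x. indicator {x. c *\<^sub>R x \<in> A} x \<partial>lborel) = emeasure lborel {x. c *\<^sub>R x \<in> A}"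
    by (rule nn_integral_indicator) measurable
  finally show ?thesis .
qed

lemma One_component: "(One :: real ^ 'k) $ i = 1"
proof -
  have "axis i 1 \<in> (Basis :: (real ^ 'k) set)" by (auto simp: Basis_vec_def)
  then have "(One :: real ^ 'k) \<bullet> axis i 1 = 1" by simp
  then show ?thesis by (simp add: inner_axis)
qed

lemma inner_One_vec: "x \<bullet> (One :: real ^ 'k) = (\<Sum>i\<in>UNIV. x $ i)"
  by (simp only: inner_vec_def One_component inner_real_def mult_1_right)

lemma subspace_sum_zero_hyperplane: "subspace (sum_zero_hyperplane :: (real ^ 'k) set)"
  by (auto simp: sum_zero_hyperplane_def subspace_def sum.distrib sum_distrib_left[symmetric])

abbreviation unit_normal :: "real ^ 'k" where
  "unit_normal \<equiv> (1 / sqrt (real CARD('k))) *\<^sub>R One"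

lemma orthonormal_basis_insert_normal:
  assumes "orthonormal_basis_of (sum_zero_hyperplane :: (real ^ 'k) set) B"
  shows "orthonormal_basis_of UNIV (insert unit_normal B)" "unit_normal \<notin> B"
proof -
  let ?n = "unit_normal :: real ^ 'k"
  have card: "real CARD('k) > 0" by simp
  have o: "pairwise orthogonal B" and nm: "\<And>b. b \<in> B \<Longrightarrow> norm b = 1" and s: "span B = sum_zero_hyperplane"
    using assms by (auto simp: orthonormal_basis_of_def)
  have H: "x \<in> sum_zero_hyperplane \<longleftrightarrow> x \<bullet> (One::real^'k) = 0" for x
    by (simp add: inner_One_vec sum_zero_hyperplane_def)
  have BH: "b \<bullet> One = 0" if "b \<in> B" for b
    using that s H span_base by blast
  have OO: "(One::real^'k) \<bullet> One = real CARD('k)"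
    unfolding inner_One_vec One_component by simp
  have nn: "?n \<bullet> ?n = 1" using card by (simp add: OO)
  show nB: "?n \<notin> B" using BH[of ?n] nn by (auto simp: OO)
  have "span (insert ?n B) = UNIV"
  proof (intro equalityI subset_UNIV subsetI)
    fix x :: "real ^ 'k"
    let ?y = "x - (x \<bullet> ?n) *\<^sub>R ?n"
    have "?y \<bullet> One = 0" using card by (simp add: inner_diff_left OO)
    then have "?y \<in> span B" using H s by auto
    then have "?y \<in> span (insert ?n B)" using span_mono[of B "insert ?n B"] by auto
    moreover have "(x \<bullet> ?n) *\<^sub>R ?n \<in> span (insert ?n B)" by (intro span_mul span_base) simp
    ultimately have "?y + (x \<bullet> ?n) *\<^sub>R ?n \<in> span (insert ?n B)" by (rule span_add)
    then show "x \<in> span (insert ?n B)" by simp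
  qed
  moreover have "pairwise orthogonal (insert ?n B)"
    using o BH by (auto simp: pairwise_insert orthogonal_def inner_commute[of One])
  moreover have "norm ?n = 1" using nn norm_eq_1 by blast
  ultimately show "orthonormal_basis_of UNIV (insert ?n B)"
    using nm by (auto simp: orthonormal_basis_of_def)
qed

text \<open>\<open>N\<close> is a measure on the ambient space carried by the hyperplane. The third
  claim is Cavalieri's principle along the normal, obtained by completing the chosen basis of the
  hyperplane with \<open>unit_normal\<close>; it links \<open>Delta\<close> to volumes.\<close>

lemma hyperplane_measure:
  fixes S :: "(real ^ 'k) set"
  defines "N \<equiv> subspace_lborel (sum_zero_hyperplane :: (real ^ 'k) set)"
  shows "sets N = sets borel"
    and "S \<in> sets borel \<Longrightarrow> emeasure N S = emeasure N (S \<inter> sum_zero_hyperplane)"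
    and "S \<in> sets borel \<Longrightarrow>
      emeasure lborel S = (\<integral>\<^sup>+s. emeasure N {x. x + s *\<^sub>R unit_normal \<in> S} \<partial>lborel)"
proof -
  define B where "B = (SOME B. orthonormal_basis_of (sum_zero_hyperplane :: (real ^ 'k) set) B)"
  have B: "orthonormal_basis_of (sum_zero_hyperplane :: (real ^ 'k) set) B"
    unfolding B_def by (rule orthonormal_basis_of_SOME[OF subspace_sum_zero_hyperplane])
  have N: "N = distr (\<Pi>\<^sub>M b\<in>B. lborel) borel (\<lambda>f. \<Sum>b\<in>B. f b *\<^sub>R b)"
    by (simp add: N_def subspace_lborel_def B_def Let_def)
  show sN: "sets N = sets borel" by (simp add: N)
  have [measurable]: "(sum_zero_hyperplane :: (real ^ 'k) set) \<in> sets borel"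
    by (intro borel_closed closed_subspace subspace_sum_zero_hyperplane)
  have inH: "(\<Sum>b\<in>B. f b *\<^sub>R b) \<in> sum_zero_hyperplane" for f
  proof -
    have "(\<Sum>b\<in>B. f b *\<^sub>R b) \<in> span B" by (intro span_sum span_mul span_base)
    then show ?thesis using B by (simp add: orthonormal_basis_of_def)
  qed
  show "emeasure N S = emeasure N (S \<inter> sum_zero_hyperplane)" if [measurable]: "S \<in> sets borel"
    unfolding N using inH by (subst (1 2) emeasure_distr) (auto intro!: arg_cong2[where f=emeasure])
  note U = orthonormal_basis_insert_normal[OF B]
  have fin: "finite B" using orthonormal_expansion(1)[OF U(1)] by simp
  show "emeasure lborel S = (\<integral>\<^sup>+s. emeasure N {x. x + s *\<^sub>R unit_normal \<in> S} \<partial>lborel)"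
    if [measurable]: "S \<in> sets borel"
  proof -
    let ?n = "unit_normal :: real ^ 'k"
    interpret product_sigma_finite "\<lambda>_::real^'k. lborel :: real measure" ..
    have "emeasure lborel S = (\<integral>\<^sup>+x. indicator S x \<partial>lborel)" by simp
    also have "\<dots> = (\<integral>\<^sup>+f. indicator S (\<Sum>b\<in>insert ?n B. f b *\<^sub>R b) \<partial>(\<Pi>\<^sub>M b\<in>insert ?n B. lborel))"
      by (subst lborel_eq_distr_orthonormal[OF U(1), symmetric], subst nn_integral_distr) auto
    also have "\<dots> = (\<integral>\<^sup>+s. (\<integral>\<^sup>+f. indicator S (\<Sum>b\<in>insert ?n B. (f(?n := s)) b *\<^sub>R b) \<partial>(\<Pi>\<^sub>M b\<in>B. lborel)) \<partial>lborel)"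
      by (rule product_nn_integral_insert_rev[OF fin U(2)]) measurable
    also have "\<dots> = (\<integral>\<^sup>+s. (\<integral>\<^sup>+f. indicator {x. x + s *\<^sub>R ?n \<in> S} (\<Sum>b\<in>B. f b *\<^sub>R b) \<partial>(\<Pi>\<^sub>M b\<in>B. lborel)) \<partial>lborel)"
    proof (intro nn_integral_cong)
      fix s f
      have "(\<Sum>b\<in>B. (f(?n := s)) b *\<^sub>R b) = (\<Sum>b\<in>B. f b *\<^sub>R b)"
        using U(2) by (intro sum.cong) auto
      then show "(indicator S (\<Sum>b\<in>insert ?n B. (f(?n := s)) b *\<^sub>R b) :: ennreal) =
          indicator {x. x + s *\<^sub>R ?n \<in> S} (\<Sum>b\<in>B. f b *\<^sub>R b)"
        using fin U(2) by (simp add: indicator_def add.commute)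
    qed
    also have "\<dots> = (\<integral>\<^sup>+s. (\<integral>\<^sup>+x. indicator {x. x + s *\<^sub>R ?n \<in> S} x \<partial>N) \<partial>lborel)"
      unfolding N by (intro nn_integral_cong nn_integral_distr[symmetric]) measurable
    also have "\<dots> = (\<integral>\<^sup>+s. emeasure N {x. x + s *\<^sub>R ?n \<in> S} \<partial>lborel)"
      by (intro nn_integral_cong nn_integral_indicator) (simp add: sN)
    finally show ?thesis .
  qed
qed

text \<open>The slab has measure asymptotic to \<open>2 * \<delta> * Delta\<close>. To get a lower
  bound at positive width, the cube is enlarged by \<open>l\<close> until it contains a cylinder
  over the central section \<open>K\<close>; scaling back costs the factor
  \<open>l ^ CARD('k)\<close>.\<close>

lemma Delta_slab:
  assumes l: "l > 1"
  shows "Delta TYPE('k::finite) > 0"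
    and "\<exists>\<delta>0>0. \<forall>\<delta>. 0 < \<delta> \<and> \<delta> < \<delta>0 \<longrightarrow>
      ennreal (2 * \<delta> * Delta TYPE('k) / l ^ CARD('k)) \<le>
        emeasure lborel {\<xi>\<in>half_cube. \<bar>\<xi> \<bullet> (One :: real ^ 'k)\<bar> < \<delta>}"
proof -
  define N where "N = subspace_lborel (sum_zero_hyperplane :: (real ^ 'k) set)"
  define K where "K = {x :: real ^ 'k. (\<forall>i. x $ i \<in> {-1..1}) \<and> (\<Sum>i\<in>UNIV. x $ i) = 0}"
  define d where "d = real CARD('k)"
  have d: "d > 0" by (simp add: d_def)
  let ?n = "unit_normal :: real ^ 'k"
  have n_i: "?n $ i = 1 / sqrt d" for i
    by (simp only: vector_scaleR_component One_component real_scaleR_def d_def mult_1_right)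
  have n_One: "?n \<bullet> One = sqrt d"
    unfolding inner_One_vec n_i using d by (simp add: d_def real_div_sqrt)
  have comp: "(x + s *\<^sub>R ?n) $ i = x $ i + s / sqrt d" for x s i
    by (simp only: vector_add_component vector_scaleR_component One_component) (simp add: d_def)
  have inn: "(x + s *\<^sub>R ?n) \<bullet> One = x \<bullet> One + s * sqrt d" for x s
    by (simp only: inner_add_left inner_scaleR_left[of s ?n] n_One)
  note hm = hyperplane_measure[where 'k='k, folded N_def]
  have Kb[measurable]: "K \<in> sets borel"
    unfolding K_def by measurable
  \<comment> \<open>Cylinder over \<open>K\<close>: a step \<open>s\<close> along
    \<open>unit_normal\<close> changes the coordinate sum by \<open>s * sqrt d\<close>, which gives
    half height \<open>\<delta> / sqrt d\<close>, and moves each coordinate by at most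
    \<open>\<delta> / d\<close>.\<close>
  have slab_ge: "emeasure N K * ennreal (2 * \<delta> / sqrt d) \<le> emeasure lborel
      {x :: real ^ 'k. (\<forall>i. \<bar>x $ i\<bar> \<le> l) \<and> \<bar>x \<bullet> One\<bar> < \<delta>}"
    if "\<delta> > 0" "1 + \<delta> / d \<le> l" for \<delta> l
  proof -
    let ?S = "{x :: real ^ 'k. (\<forall>i. \<bar>x $ i\<bar> \<le> l) \<and> \<bar>x \<bullet> One\<bar> < \<delta>}"
    have [measurable]: "?S \<in> sets borel" by measurable
    have "emeasure N K * ennreal (2 * \<delta> / sqrt d) =
        (\<integral>\<^sup>+s. emeasure N K * indicator {- (\<delta> / sqrt d)<..<\<delta> / sqrt d} s \<partial>lborel)"
      using that d by (subst nn_integral_cmult) auto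
    also have "\<dots> \<le> (\<integral>\<^sup>+s. emeasure N {x. x + s *\<^sub>R ?n \<in> ?S} \<partial>lborel)"
    proof (intro nn_integral_mono)
      fix s
      show "emeasure N K * indicator {- (\<delta> / sqrt d)<..<\<delta> / sqrt d} s \<le> emeasure N {x. x + s *\<^sub>R ?n \<in> ?S}"
      proof (cases "s \<in> {- (\<delta> / sqrt d)<..<\<delta> / sqrt d}")
        case True
        then have s: "\<bar>s\<bar> < \<delta> / sqrt d" by auto
        then have s1: "\<bar>s\<bar> * sqrt d < \<delta>" using d by (simp add: field_simps)
        have s2: "\<bar>s\<bar> / sqrt d \<le> \<delta> / d"
        proof -
          have "\<bar>s\<bar> / sqrt d = \<bar>s\<bar> * sqrt d / (sqrt d * sqrt d)"
            using d by (simp del: real_sqrt_mult_self)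
          also have "\<dots> \<le> \<delta> / d" using s1 d by (simp add: divide_right_mono)
          finally show ?thesis .
        qed
        have "K \<subseteq> {x. x + s *\<^sub>R ?n \<in> ?S}"
        proof
          fix x assume x: "x \<in> K"
          have "\<bar>(x + s *\<^sub>R ?n) $ i\<bar> \<le> l" for i
          proof -
            have "\<bar>(x + s *\<^sub>R ?n) $ i\<bar> \<le> \<bar>x $ i\<bar> + \<bar>s\<bar> / sqrt d"
              unfolding comp using d abs_triangle_ineq[of "x $ i" "s / sqrt d"] by simp
            also have "\<bar>x $ i\<bar> \<le> 1" using x by (auto simp: K_def abs_le_iff minus_le_iff)
            finally show ?thesis using s2 that(2) by linarith
          qed
          moreover have "(x + s *\<^sub>R ?n) \<bullet> One = s * sqrt d"
          proof -
            have "x \<bullet> One = 0" using x by (simp add: K_def inner_One_vec)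
            then show ?thesis by (simp only: inn add_0)
          qed
          ultimately show "x \<in> {x. x + s *\<^sub>R ?n \<in> ?S}"
            using s1 d by (simp add: abs_mult)
        qed
        then have "emeasure N K \<le> emeasure N {x. x + s *\<^sub>R ?n \<in> ?S}"
          by (intro emeasure_mono) (auto simp: hm(1))
        then show ?thesis using True by simp
      qed simp
    qed
    also have "\<dots> = emeasure lborel ?S" by (rule hm(3)[symmetric]) measurable
    finally show ?thesis .
  qed
  \<comment> \<open>\<open>Delta\<close> uses \<open>measure\<close>, which is 0 on sets of infinite
    measure. The bounded slab with \<open>\<delta> = d\<close> and \<open>l = 2\<close> excludes
    this.\<close>
  have fin: "emeasure N K < \<infinity>"
  proof -
    let ?S = "{x :: real ^ 'k. (\<forall>i. \<bar>x $ i\<bar> \<le> 2) \<and> \<bar>x \<bullet> One\<bar> < d}"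
    have "?S \<subseteq> cbox (\<chi> i. -2) (\<chi> i. 2)"
      by (auto simp: mem_box_cart abs_le_iff minus_le_iff)
    then have "bounded ?S" by (rule bounded_subset[OF bounded_cbox])
    then have "emeasure lborel ?S < \<infinity>" by (rule emeasure_bounded_finite)
    then have "emeasure N K * ennreal (2 * d / sqrt d) < \<infinity>"
      using slab_ge[of d 2] d by (auto intro: le_less_trans)
    moreover have "2 * d / sqrt d > 0" using d by simp
    ultimately show ?thesis
      by (metis ennreal_eq_0_iff ennreal_top_mult infinity_ennreal_def less_irrefl linorder_not_le top.not_eq_extremum)
  qed
  then have V: "emeasure N K = ennreal (measure N K)"
    by (simp add: emeasure_eq_ennreal_measure less_top)
  have De: "measure N K = 2 ^ (CARD('k) - 1) * sqrt d * Delta TYPE('k)"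
    using d by (simp add: Delta_def N_def K_def d_def)
  \<comment> \<open>Otherwise every slice of the half cube would be null: moved into the hyperplane
    it lies in \<open>K\<close>, because the shift \<open>?r\<close> is the mean of coordinates
    bounded by 1/2. The half cube would then have volume 0.\<close>
  have "measure N K > 0"
  proof (rule ccontr)
    assume "\<not> measure N K > 0"
    then have "emeasure N K = 0" using V by (simp add: ennreal_neg measure_nonneg not_less)
    have "emeasure N {x. x + s *\<^sub>R ?n \<in> half_cube} = 0" for s
    proof -
      have "emeasure N {x. x + s *\<^sub>R ?n \<in> half_cube} =
          emeasure N ({x. x + s *\<^sub>R ?n \<in> half_cube} \<inter> sum_zero_hyperplane)"
        by (rule hm(2)) measurable
      also have "\<dots> \<le> emeasure N K"
      proof (rule emeasure_mono)
        show "{x. x + s *\<^sub>R ?n \<in> half_cube} \<inter> sum_zero_hyperplane \<subseteq> K"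
        proof
          fix x assume x: "x \<in> {x. x + s *\<^sub>R ?n \<in> half_cube} \<inter> sum_zero_hyperplane"
          let ?r = "s / sqrt d"
          have xi: "\<bar>x $ i + ?r\<bar> \<le> 1/2" for i
          proof -
            have "\<bar>(x + s *\<^sub>R ?n) \<bullet> axis i 1\<bar> \<le> 1/2"
              using x by (auto simp: half_cube_def Basis_vec_def)
            then show ?thesis by (simp only: inner_axis comp inner_real_def mult_1_right)
          qed
          have sx: "(\<Sum>i\<in>UNIV. x $ i) = 0" using x by (simp add: sum_zero_hyperplane_def)
          have "d * \<bar>?r\<bar> = \<bar>\<Sum>i\<in>(UNIV::'k set). x $ i + ?r\<bar>"
            by (simp add: sum.distrib sx d_def abs_mult)
          also have "\<dots> \<le> (\<Sum>i\<in>(UNIV::'k set). \<bar>x $ i + ?r\<bar>)" by (rule sum_abs)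
          also have "\<dots> \<le> (\<Sum>i\<in>(UNIV::'k set). 1/2)" by (intro sum_mono xi)
          also have "\<dots> = d * (1/2)" by (simp add: d_def)
          finally have "\<bar>?r\<bar> \<le> 1/2" using d mult_le_cancel_left_pos by blast
          then have "\<bar>x $ i\<bar> \<le> 1" for i using xi[of i] by linarith
          then show "x \<in> K" using sx by (auto simp: K_def abs_le_iff minus_le_iff)
        qed
      qed (simp add: hm(1))
      finally show ?thesis using \<open>emeasure N K = 0\<close> by simp
    qed
    then have "emeasure lborel (half_cube :: (real ^ 'k) set) = 0"
      by (subst hm(3)) auto
    then show False by (simp add: emeasure_half_cube)
  qed
  then show Dpos: "Delta TYPE('k) > 0"
    unfolding De by (rule zero_less_mult_pos) (use d in simp)
  show "\<exists>\<delta>0>0. \<forall>\<delta>. 0 < \<delta> \<and> \<delta> < \<delta>0 \<longrightarrow>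
      ennreal (2 * \<delta> * Delta TYPE('k) / l ^ CARD('k)) \<le>
        emeasure lborel {\<xi>\<in>half_cube. \<bar>\<xi> \<bullet> (One :: real ^ 'k)\<bar> < \<delta>}"
  \<comment> \<open>Scaling by \<open>2 * l\<close> takes the half cube to the cube of half side
    \<open>l\<close> and \<open>\<delta>\<close> to \<open>\<delta>'\<close>; the threshold is what
    \<open>1 + \<delta>' / d \<le> l\<close> requires.\<close>
  proof (intro exI[of _ "d * (l - 1) / (2 * l)"] conjI allI impI)
    show "0 < d * (l - 1) / (2 * l)" using l d by simp
    fix \<delta> assume \<delta>: "0 < \<delta> \<and> \<delta> < d * (l - 1) / (2 * l)"
    define \<delta>' where "\<delta>' = 2 * l * \<delta>"
    have \<delta>': "\<delta>' > 0" "1 + \<delta>' / d \<le> l"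
      using \<delta> l d by (auto simp: \<delta>'_def field_simps)
    let ?S = "{x :: real ^ 'k. (\<forall>i. \<bar>x $ i\<bar> \<le> l) \<and> \<bar>x \<bullet> One\<bar> < \<delta>'}"
    have Sm: "?S \<in> sets borel" by measurable
    have eq: "{x. (2 * l) *\<^sub>R x \<in> ?S} = {\<xi>\<in>half_cube. \<bar>\<xi> \<bullet> (One :: real ^ 'k)\<bar> < \<delta>}"
    proof -
      have 1: "\<bar>(2 * l) * y\<bar> \<le> l \<longleftrightarrow> \<bar>y\<bar> \<le> 1/2" "\<bar>(2 * l) * y\<bar> < \<delta>' \<longleftrightarrow> \<bar>y\<bar> < \<delta>" for y
        using l by (auto simp: abs_mult \<delta>'_def)
      have 2: "x \<in> half_cube \<longleftrightarrow> (\<forall>i. \<bar>x $ i\<bar> \<le> 1/2)" for x :: "real ^ 'k"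
        by (auto simp: half_cube_def Basis_vec_def inner_axis)
      show ?thesis
        unfolding 2 mem_Collect_eq vector_scaleR_component inner_scaleR_left 1 real_scaleR_def by simp
    qed
    have "ennreal ((2 * l) ^ CARD('k)) * ennreal (2 * \<delta> * Delta TYPE('k) / l ^ CARD('k)) \<le>
        ennreal (measure N K * (2 * \<delta>' / sqrt d))"
    proof (subst ennreal_mult[symmetric])
      have "(2::real) ^ CARD('k) = 2 * 2 ^ (CARD('k) - 1)"
        by (metis One_nat_def Suc_pred power_Suc zero_less_card_finite)
      then have "(2 * l) ^ CARD('k) * (2 * \<delta> * Delta TYPE('k) / l ^ CARD('k)) =
          2 ^ (CARD('k) - 1) * Delta TYPE('k) * (2 * (2 * \<delta>))"
        using l by (simp add: power_mult_distrib)
      also have "\<dots> \<le> 2 ^ (CARD('k) - 1) * Delta TYPE('k) * (2 * \<delta>')"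
        using \<delta> l \<open>Delta TYPE('k) > 0\<close> by (intro mult_left_mono) (auto simp: \<delta>'_def)
      also have "\<dots> = measure N K * (2 * \<delta>' / sqrt d)"
        using d by (simp add: De)
      finally show "ennreal ((2 * l) ^ CARD('k) * (2 * \<delta> * Delta TYPE('k) / l ^ CARD('k))) \<le>
        ennreal (measure N K * (2 * \<delta>' / sqrt d))" by (rule ennreal_leI)
    qed (use l \<delta> \<open>Delta TYPE('k) > 0\<close> in auto)
    also have "\<dots> = emeasure N K * ennreal (2 * \<delta>' / sqrt d)"
      unfolding V using \<delta>' d by (intro ennreal_mult) auto
    also have "\<dots> \<le> emeasure lborel ?S" by (rule slab_ge[OF \<delta>'])
    also have "\<dots> = ennreal ((2 * l) ^ CARD('k)) * emeasure lborel {\<xi>\<in>half_cube. \<bar>\<xi> \<bullet> (One :: real ^ 'k)\<bar> < \<delta>}"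
      using emeasure_lborel_scale[of "2 * l" ?S, OF _ Sm] l unfolding eq by simp
    finally show "ennreal (2 * \<delta> * Delta TYPE('k) / l ^ CARD('k)) \<le>
        emeasure lborel {\<xi>\<in>half_cube. \<bar>\<xi> \<bullet> (One :: real ^ 'k)\<bar> < \<delta>}"
      using l by (subst (asm) ennreal_mult_le_mult_iff) auto
  qed
qed

section \<open>Blichfeldt's principle for sections of a lattice\<close>

definition integer_points :: "'a::euclidean_space set" where
  "integer_points = {k. \<forall>b\<in>Basis. k \<bullet> b \<in> \<int>}"

lemma inj_on_coordinates: "inj (\<lambda>x::'a::euclidean_space. restrict (\<lambda>b. x \<bullet> b) Basis)"
proof (rule injI)
  fix x y :: 'a assume eq: "restrict (\<lambda>b. x \<bullet> b) Basis = restrict (\<lambda>b. y \<bullet> b) Basis"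
  have "x \<bullet> b = y \<bullet> b" if "b \<in> Basis" for b
    using fun_cong[OF eq, of b] that by simp
  then show "x = y" by (rule euclidean_eqI)
qed

lemma countable_integer_points: "countable (integer_points :: 'a::euclidean_space set)"
proof -
  have "(\<lambda>x. restrict (\<lambda>b. x \<bullet> b) Basis) ` integer_points \<subseteq> Pi\<^sub>E (Basis :: 'a set) (\<lambda>_. \<int>)"
    by (auto simp: integer_points_def)
  moreover have "countable (Pi\<^sub>E (Basis :: 'a set) (\<lambda>_. \<int> :: real set))"
    by (intro countable_PiE) (auto simp: Ints_def)
  ultimately show ?thesis
    using countable_image_inj_on[OF countable_subset inj_on_subset[OF inj_on_coordinates subset_UNIV]]
    by blast
qed

lemma finite_bounded_integer_points:
  "finite {k \<in> (integer_points :: 'a::euclidean_space set). \<forall>b\<in>Basis. \<bar>k \<bullet> b\<bar> \<le> C}"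
proof -
  have "(\<lambda>x. restrict (\<lambda>b. x \<bullet> b) Basis) ` {k \<in> integer_points. \<forall>b\<in>Basis. \<bar>k \<bullet> b\<bar> \<le> C} \<subseteq>
      Pi\<^sub>E (Basis :: 'a set) (\<lambda>_. {x \<in> \<int>. \<bar>x\<bar> \<le> C})"
    by (auto simp: integer_points_def)
  moreover have "finite (Pi\<^sub>E (Basis :: 'a set) (\<lambda>_. {x \<in> \<int>. \<bar>x\<bar> \<le> C}))"
    by (intro finite_PiE finite_abs_int_segment) auto
  ultimately show ?thesis
    using finite_imageD[OF finite_subset inj_on_subset[OF inj_on_coordinates subset_UNIV]] by blast
qed

text \<open>For a lattice \<open>L\<close> this holds with \<open>C\<close> its covolume.\<close>

definition blichfeldt_bound :: "'a::euclidean_space set \<Rightarrow> ennreal \<Rightarrow> bool" where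
  "blichfeldt_bound L C \<longleftrightarrow>
     (\<forall>A \<in> sets borel. C < emeasure lborel A \<longrightarrow> (\<exists>x\<in>A. \<exists>y\<in>A. x \<noteq> y \<and> x - y \<in> L))"

text \<open>Cut \<open>A\<close> along the unit cells (\<open>Y k\<close> lies in the cell at
  \<open>k\<close>) and move the pieces into the cell \<open>C\<close> (giving \<open>X k\<close>).
  If no two points of \<open>A\<close> differ by a nonzero integer point, the moved pieces are
  disjoint and their total volume is at most 1.\<close>

lemma blichfeldt_integer_points: "blichfeldt_bound (integer_points :: 'a::euclidean_space set) 1"
  unfolding blichfeldt_bound_def
proof (intro ballI impI, rule ccontr)
  fix A :: "'a set"
  assume A[measurable]: "A \<in> sets borel" and gt: "1 < emeasure lborel A"
    and no: "\<not> (\<exists>x\<in>A. \<exists>y\<in>A. x \<noteq> y \<and> x - y \<in> integer_points)"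
  let ?Z = "integer_points :: 'a set"
  define C :: "'a set" where "C = {x. \<forall>b\<in>Basis. 0 \<le> x \<bullet> b \<and> x \<bullet> b < 1}"
  have C[measurable]: "C \<in> sets borel" unfolding C_def by measurable
  define X where "X k = {x \<in> C. x + k \<in> A}" for k
  define Y where "Y k = {x \<in> A. x - k \<in> C}" for k
  have X[measurable]: "X k \<in> sets borel" and Y[measurable]: "Y k \<in> sets borel" for k
    unfolding X_def Y_def by measurable
  have "A = (\<Union>k\<in>?Z. Y k)"
  proof (intro equalityI subsetI)
    fix x assume x: "x \<in> A"
    define k where "k = (\<Sum>b\<in>Basis. of_int \<lfloor>x \<bullet> b\<rfloor> *\<^sub>R b)"
    have kb: "k \<bullet> b = of_int \<lfloor>x \<bullet> b\<rfloor>" if "b \<in> Basis" for b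
      using that by (simp add: k_def inner_sum_left_Basis)
    have "k \<in> ?Z" by (auto simp: integer_points_def kb)
    moreover have "x - k \<in> C"
      by (auto simp: C_def inner_diff_left kb) linarith
    ultimately show "x \<in> (\<Union>k\<in>?Z. Y k)" using x by (auto simp: Y_def)
  qed (auto simp: Y_def)
  then have "emeasure lborel A = emeasure lborel (\<Union>k\<in>?Z. Y k)" by simp
  also have "\<dots> = (\<integral>\<^sup>+k. emeasure lborel (Y k) \<partial>count_space ?Z)"
  proof (rule emeasure_UN_countable)
    show "disjoint_family_on Y ?Z"
      unfolding disjoint_family_on_def
    proof (intro ballI impI)
      fix j k assume jk: "j \<in> ?Z" "k \<in> ?Z" "j \<noteq> k"
      have False if x: "x \<in> Y j \<inter> Y k" for x
      proof -
        have "j \<bullet> b = k \<bullet> b" if b: "b \<in> Basis" for b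
        proof -
          have "j \<bullet> b \<in> \<int>" "k \<bullet> b \<in> \<int>" using jk b by (auto simp: integer_points_def)
          moreover have "\<bar>j \<bullet> b - k \<bullet> b\<bar> < 1"
            using x b by (fastforce simp: Y_def C_def inner_diff_left)
          ultimately show ?thesis by (metis Ints_diff Ints_nonzero_abs_less1 eq_iff_diff_eq_0)
        qed
        then show False using jk(3) euclidean_eqI by blast
      qed
      then show "Y j \<inter> Y k = {}" by blast
    qed
  qed (auto simp: countable_integer_points)
  also have "\<dots> = (\<integral>\<^sup>+k. emeasure lborel (X k) \<partial>count_space ?Z)"
  proof (intro nn_integral_cong)
    fix k
    have "emeasure lborel (Y k) = emeasure (distr lborel borel ((+) k)) (Y k)"
      by (simp add: lborel_distr_plus)
    also have "\<dots> = emeasure lborel (X k)"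
      by (subst emeasure_distr)
         (auto simp: X_def Y_def add.commute intro!: arg_cong2[where f=emeasure])
    finally show "emeasure lborel (Y k) = emeasure lborel (X k)" .
  qed
  also have "\<dots> = emeasure lborel (\<Union>k\<in>?Z. X k)"
  proof (rule emeasure_UN_countable[symmetric])
    show "disjoint_family_on X ?Z"
      unfolding disjoint_family_on_def
    proof (intro ballI impI)
      fix j k assume jk: "j \<in> ?Z" "k \<in> ?Z" "j \<noteq> k"
      have False if x: "x \<in> X j \<inter> X k" for x
      proof -
        have "(x + j) - (x + k) \<in> ?Z" using jk by (auto simp: integer_points_def inner_diff_left)
        moreover have "x + j \<in> A" "x + k \<in> A" "x + j \<noteq> x + k" using x jk(3) by (auto simp: X_def)
        ultimately show False using no by blast
      qed
      then show "X j \<inter> X k = {}" by blast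
    qed
  qed (auto simp: countable_integer_points)
  also have "\<dots> \<le> emeasure lborel (cbox 0 (One :: 'a))"
    by (rule emeasure_mono) (auto simp: X_def C_def mem_box less_imp_le)
  also have "\<dots> = 1" by (subst emeasure_lborel_cbox_eq) auto
  finally show False using gt by simp
qed

text \<open>Below, \<open>w\<close> has integral inner products with a lattice. Stacking \<open>N\<close> translates of a set of width less
  than \<open>1/N\<close> in direction \<open>w\<close> multiplies its measure by \<open>N\<close>, while lattice differences of the stack
  are still differences of the original set, and orthogonal to \<open>w\<close>.\<close>

lemma stack_translates:
  fixes A :: "'a::euclidean_space set"
  assumes A[measurable]: "A \<in> sets borel" and N: "N > 0" and e: "e \<bullet> w = 1"
    and width: "\<And>x y. x \<in> A \<Longrightarrow> y \<in> A \<Longrightarrow> \<bar>(x - y) \<bullet> w\<bar> < 1 / real N"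
  obtains A' where "A' \<in> sets borel" "emeasure lborel A' = of_nat N * emeasure lborel A"
    "\<And>p. p \<in> A' \<Longrightarrow> \<exists>x\<in>A. \<exists>t. p = x + t *\<^sub>R e"
    "\<And>p q. p \<in> A' \<Longrightarrow> q \<in> A' \<Longrightarrow> (p - q) \<bullet> w \<in> \<int> \<Longrightarrow>
       (p - q) \<bullet> w = 0 \<and> (\<exists>x\<in>A. \<exists>y\<in>A. p - q = x - y)"
proof
  define s where "s j = (real j / real N) *\<^sub>R e" for j
  define X where "X j = {x. x - s j \<in> A}" for j
  have X[measurable]: "X j \<in> sets borel" for j unfolding X_def by measurable
  show "(\<Union>j<N. X j) \<in> sets borel" by measurable
  have s_w: "s j \<bullet> w = real j / real N" for j by (simp add: s_def e)
  \<comment> \<open>Two points of \<open>A\<close> contribute less than \<open>1/N\<close> and the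
    shifts at most \<open>1 - 1/N\<close>, so an integral product is 0; then the shifts differ by
    less than \<open>1/N\<close>, hence coincide. The case \<open>p = q\<close> gives disjointness
    of the translates.\<close>
  have key: "(p - q) \<bullet> w = 0 \<and> i = j"
    if p: "p \<in> X i" "q \<in> X j" "i < N" "j < N" "(p - q) \<bullet> w \<in> \<int>" for p q i j
  proof -
    define x y where "x = p - s i" and "y = q - s j"
    have xy: "\<bar>(x - y) \<bullet> w\<bar> < 1 / real N" using p by (intro width) (auto simp: X_def x_def y_def)
    have eq: "(p - q) \<bullet> w = (x - y) \<bullet> w + (real i - real j) / real N"
      by (simp add: x_def y_def inner_diff_left s_w diff_divide_distrib)
    have "\<bar>real i - real j\<bar> \<le> real N - 1" using p by linarith
    then have "\<bar>(real i - real j) / real N\<bar> \<le> (real N - 1) / real N"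
      using N by (simp add: divide_right_mono)
    also have "\<dots> = 1 - 1 / real N" using N by (simp add: diff_divide_distrib)
    finally have "\<bar>(p - q) \<bullet> w\<bar> < 1" using xy eq by linarith
    then have 0: "(p - q) \<bullet> w = 0" using p(5) Ints_nonzero_abs_less1 by blast
    then have "\<bar>(real i - real j) / real N\<bar> < 1 / real N" using xy eq by linarith
    then have "\<bar>real i - real j\<bar> < 1" using N by (simp add: divide_less_cancel)
    then show ?thesis using 0 by linarith
  qed
  have "emeasure lborel (\<Union>j<N. X j) = (\<Sum>j<N. emeasure lborel (X j))"
  proof (rule sum_emeasure[symmetric])
    show "disjoint_family_on X {..<N}"
      using key[of x _ x for x] by (fastforce simp: disjoint_family_on_def)
  qed auto
  also have "\<dots> = (\<Sum>j<N. emeasure lborel A)"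
  proof (intro sum.cong refl)
    fix j
    have "emeasure lborel (X j) = emeasure (distr lborel borel ((+) (s j))) (X j)"
      by (simp add: lborel_distr_plus)
    also have "\<dots> = emeasure lborel A"
      by (subst emeasure_distr) (auto simp: X_def)
    finally show "emeasure lborel (X j) = emeasure lborel A" .
  qed
  finally show "emeasure lborel (\<Union>j<N. X j) = of_nat N * emeasure lborel A" by simp
  show "\<exists>x\<in>A. \<exists>t. p = x + t *\<^sub>R e" if p: "p \<in> (\<Union>j<N. X j)" for p
  proof -
    obtain j where "p - s j \<in> A" using p unfolding X_def by blast
    then show ?thesis by (intro bexI[of _ "p - s j"] exI[of _ "real j / real N"]) (auto simp: s_def)
  qed
  show "(p - q) \<bullet> w = 0 \<and> (\<exists>x\<in>A. \<exists>y\<in>A. p - q = x - y)"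
    if pq: "p \<in> (\<Union>j<N. X j)" "q \<in> (\<Union>j<N. X j)" "(p - q) \<bullet> w \<in> \<int>" for p q
  proof -
    obtain i j where ij: "i < N" "j < N" "p \<in> X i" "q \<in> X j" using pq by auto
    then have k: "(p - q) \<bullet> w = 0" "i = j" using key pq(3) by blast+
    have "p - q = (p - s i) - (q - s j)" using k by simp
    moreover have "p - s i \<in> A" "q - s j \<in> A" using ij by (auto simp: X_def)
    ultimately show ?thesis using k by blast
  qed
qed

text \<open>A set thin in direction \<open>w\<close> needs only the \<open>N\<close>-th part of the
  volume. The difference found is orthogonal to \<open>w\<close>, since its product with
  \<open>w\<close> is an integer of absolute value below \<open>1/N\<close>.\<close>

lemma lattice_difference_orthogonal:
  fixes A :: "'a::euclidean_space set"
  assumes L: "blichfeldt_bound L C" and w: "\<And>k. k \<in> L \<Longrightarrow> k \<bullet> w \<in> \<int>" "w \<noteq> 0"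
    and A: "A \<in> sets borel" and N: "N > 0"
    and width: "\<And>x y. x \<in> A \<Longrightarrow> y \<in> A \<Longrightarrow> \<bar>(x - y) \<bullet> w\<bar> < 1 / real N"
    and C: "C < of_nat N * emeasure lborel A"
  shows "\<exists>x\<in>A. \<exists>y\<in>A. x \<noteq> y \<and> x - y \<in> L"
proof -
  define e where "e = (1 / (w \<bullet> w)) *\<^sub>R w"
  have e: "e \<bullet> w = 1" using w(2) by (simp add: e_def)
  obtain A' where A': "A' \<in> sets borel" "emeasure lborel A' = of_nat N * emeasure lborel A"
    "\<And>p q. p \<in> A' \<Longrightarrow> q \<in> A' \<Longrightarrow> (p - q) \<bullet> w \<in> \<int> \<Longrightarrow>
       (p - q) \<bullet> w = 0 \<and> (\<exists>x\<in>A. \<exists>y\<in>A. p - q = x - y)"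
    using stack_translates[OF A N e width] by metis
  obtain p q where pq: "p \<in> A'" "q \<in> A'" "p \<noteq> q" "p - q \<in> L"
    using L A' C by (auto simp: blichfeldt_bound_def)
  then obtain x y where "x \<in> A" "y \<in> A" "p - q = x - y" using A'(3) w(1) by blast
  then show ?thesis using pq by (metis eq_iff_diff_eq_0)
qed

text \<open>Stack twice, first for \<open>w\<close>, then for \<open>v\<close>. The first shift
  vector \<open>e\<close> is orthogonal to \<open>v\<close>, so the first stack stays thin in
  direction \<open>v\<close>; it is a multiple of the part of \<open>w\<close> orthogonal to
  \<open>v\<close>, nonzero by independence.\<close>

lemma lattice_difference_orthogonal2:
  fixes A :: "'a::euclidean_space set"
  assumes L: "blichfeldt_bound L C"
    and v: "\<And>k. k \<in> L \<Longrightarrow> k \<bullet> v \<in> \<int>" "v \<noteq> 0"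
    and w: "\<And>k. k \<in> L \<Longrightarrow> k \<bullet> w \<in> \<int>" "\<And>r. w \<noteq> r *\<^sub>R v"
    and A: "A \<in> sets borel" and N: "N > 0"
    and width: "\<And>x y. x \<in> A \<Longrightarrow> y \<in> A \<Longrightarrow> \<bar>(x - y) \<bullet> v\<bar> < 1 / real N"
      "\<And>x y. x \<in> A \<Longrightarrow> y \<in> A \<Longrightarrow> \<bar>(x - y) \<bullet> w\<bar> < 1 / real N"
    and C: "C < of_nat N * (of_nat N * emeasure lborel A)"
  shows "\<exists>x\<in>A. \<exists>y\<in>A. x \<noteq> y \<and> x - y \<in> L"
proof -
  define u where "u = w - (w \<bullet> v / (v \<bullet> v)) *\<^sub>R v"
  have u0: "u \<noteq> 0" using w(2)[of "w \<bullet> v / (v \<bullet> v)"] by (simp add: u_def)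
  have uv: "u \<bullet> v = 0" using v(2) by (simp add: u_def inner_diff_left)
  have uw: "u \<bullet> w = u \<bullet> u"
    using uv by (simp add: u_def inner_diff_right)
  define e where "e = (1 / (u \<bullet> u)) *\<^sub>R u"
  have e: "e \<bullet> w = 1" "e \<bullet> v = 0" using u0 uv by (simp_all add: e_def uw)
  obtain A' where A': "A' \<in> sets borel" "emeasure lborel A' = of_nat N * emeasure lborel A"
    "\<And>p. p \<in> A' \<Longrightarrow> \<exists>x\<in>A. \<exists>t. p = x + t *\<^sub>R e"
    "\<And>p q. p \<in> A' \<Longrightarrow> q \<in> A' \<Longrightarrow> (p - q) \<bullet> w \<in> \<int> \<Longrightarrow>
       (p - q) \<bullet> w = 0 \<and> (\<exists>x\<in>A. \<exists>y\<in>A. p - q = x - y)"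
    using stack_translates[OF A N e(1) width(2)] by metis
  have "\<exists>x\<in>A'. \<exists>y\<in>A'. x \<noteq> y \<and> x - y \<in> L"
  proof (rule lattice_difference_orthogonal[OF L v A'(1) N])
    fix p q assume "p \<in> A'" "q \<in> A'"
    then obtain x y s t where "x \<in> A" "y \<in> A" "p = x + s *\<^sub>R e" "q = y + t *\<^sub>R e"
      using A'(3) by metis
    moreover from this have "(p - q) \<bullet> v = (x - y) \<bullet> v" by (simp add: inner_diff_left inner_add_left e)
    ultimately show "\<bar>(p - q) \<bullet> v\<bar> < 1 / real N" using width(1) by simp
  qed (use C A'(2) in simp_all)
  then obtain p q where pq: "p \<in> A'" "q \<in> A'" "p \<noteq> q" "p - q \<in> L" by blast
  then obtain x y where "x \<in> A" "y \<in> A" "p - q = x - y" using A'(4) w(1) by blast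
  then show ?thesis using pq by (metis eq_iff_diff_eq_0)
qed

section \<open>The dual lattice and its covolume\<close>

lemma nn_integral_affine:
  fixes f :: "'a::euclidean_space \<Rightarrow> ennreal"
  assumes [measurable]: "f \<in> borel_measurable borel" and c: "c \<noteq> 0"
  shows "(\<integral>\<^sup>+x. f x \<partial>lborel) = ennreal (\<bar>c\<bar> ^ DIM('a)) * (\<integral>\<^sup>+x. f (a + c *\<^sub>R x) \<partial>lborel)"
  by (subst lborel_affine[OF c, of a])
     (simp add: nn_integral_density nn_integral_distr nn_integral_cmult)

text \<open>Rescaled such that the box \<open>|p| \<le> t\<close>, \<open>|\<^sup>t\<Theta> p - q| \<le> f\<close> becomes the cube \<open>[-1,1]^d\<close>.\<close>

definition dual_lattice :: "real ^ 'm ^ 'n \<Rightarrow> real \<Rightarrow> real \<Rightarrow> ((real ^ 'n) \<times> (real ^ 'm)) set" where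
  "dual_lattice \<Theta> t f =
     {((1 / t) *\<^sub>R p, (1 / f) *\<^sub>R (transpose \<Theta> *v p - q)) | p q. integer_vector p \<and> integer_vector q}"

lemma integer_points_prod:
  "(p, q) \<in> (integer_points :: ((real ^ 'n) \<times> (real ^ 'm)) set) \<longleftrightarrow> integer_vector p \<and> integer_vector q"
  by (simp add: integer_points_def integer_vector_def Basis_prod_def Basis_vec_def inner_axis ball_Un)

text \<open>The lattice is the image of the integer points under the linear map \<open>T\<close>.
  Its determinant is read off by iterated integration: \<open>p\<close> is scaled by
  \<open>1/t\<close>, and for fixed \<open>p\<close> the variable \<open>q\<close> is scaled by
  \<open>- 1/f\<close> and translated.\<close>

lemma blichfeldt_dual_lattice:
  fixes \<Theta> :: "real ^ 'm ^ 'n"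
  assumes t: "t > 0" and f: "f > 0"
  shows "blichfeldt_bound (dual_lattice \<Theta> t f) (ennreal (1 / (t ^ CARD('n) * f ^ CARD('m))))"
  unfolding blichfeldt_bound_def
proof (intro ballI impI)
  fix A :: "((real ^ 'n) \<times> (real ^ 'm)) set"
  assume A[measurable]: "A \<in> sets borel"
    and gt: "ennreal (1 / (t ^ CARD('n) * f ^ CARD('m))) < emeasure lborel A"
  define T where "T = (\<lambda>z :: (real ^ 'n) \<times> (real ^ 'm).
    ((1 / t) *\<^sub>R fst z, (1 / f) *\<^sub>R (transpose \<Theta> *v fst z - snd z)))"
  have cont: "continuous_on UNIV T"
    unfolding T_def
    by (intro continuous_intros linear_continuous_on_compose[OF _ matrix_vector_mul_linear])
  have T[measurable]: "T \<in> borel_measurable borel"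
    by (rule borel_measurable_continuous_onI[OF cont])
  have [measurable]: "T -` A \<in> sets borel" using measurable_sets_borel[OF T A] by simp
  have [measurable]: "A \<in> sets (borel \<Otimes>\<^sub>M borel)" using A by (simp only: borel_prod)
  have [measurable]: "T -` A \<in> sets (borel \<Otimes>\<^sub>M borel)" using \<open>T -` A \<in> sets borel\<close> by (simp only: borel_prod)
  have "emeasure lborel A = emeasure (lborel \<Otimes>\<^sub>M lborel) A" by (simp add: lborel_prod)
  also have "\<dots> = (\<integral>\<^sup>+y. (\<integral>\<^sup>+z. indicator A (y, z) \<partial>lborel) \<partial>lborel)"
    by (rule lborel.emeasure_pair_measure) simp
  also have "\<dots> = ennreal ((1 / t) ^ CARD('n)) * (\<integral>\<^sup>+p. (\<integral>\<^sup>+z. indicator A ((1 / t) *\<^sub>R p, z) \<partial>lborel) \<partial>lborel)"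
    using t by (subst nn_integral_affine[where c = "1 / t" and a = 0]) auto
  also have "\<dots> = ennreal ((1 / t) ^ CARD('n)) * (\<integral>\<^sup>+p. ennreal ((1 / f) ^ CARD('m)) *
      (\<integral>\<^sup>+q. indicator A ((1 / t) *\<^sub>R p, (1 / f) *\<^sub>R (transpose \<Theta> *v p) + (- 1 / f) *\<^sub>R q) \<partial>lborel) \<partial>lborel)"
  proof (intro arg_cong2[where f="(*)"] refl nn_integral_cong)
    fix p :: "real ^ 'n"
    have "(\<lambda>z. indicator A ((1 / t) *\<^sub>R p, z) :: ennreal) \<in> borel_measurable borel" by measurable
    from nn_integral_affine[OF this, where c = "-1 / f" and a = "(1 / f) *\<^sub>R (transpose \<Theta> *v p)"]
    show "(\<integral>\<^sup>+z. indicator A ((1 / t) *\<^sub>R p, z) \<partial>lborel) = ennreal ((1 / f) ^ CARD('m)) *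
      (\<integral>\<^sup>+q. indicator A ((1 / t) *\<^sub>R p, (1 / f) *\<^sub>R (transpose \<Theta> *v p) + (- 1 / f) *\<^sub>R q) \<partial>lborel)"
      using f by simp
  qed
  also have "\<dots> = ennreal ((1 / t) ^ CARD('n)) * (\<integral>\<^sup>+p. ennreal ((1 / f) ^ CARD('m)) *
      (\<integral>\<^sup>+q. indicator (T -` A) (p, q) \<partial>lborel) \<partial>lborel)"
    by (simp add: T_def indicator_def algebra_simps)
  also have "\<dots> = ennreal ((1 / t) ^ CARD('n)) * (ennreal ((1 / f) ^ CARD('m)) * emeasure (lborel \<Otimes>\<^sub>M lborel) (T -` A))"
    by (subst lborel.emeasure_pair_measure, simp, subst nn_integral_cmult) auto
  also have "\<dots> = ennreal (1 / (t ^ CARD('n) * f ^ CARD('m))) * emeasure lborel (T -` A)"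
    using t f by (simp add: lborel_prod ennreal_mult[symmetric] mult.assoc[symmetric] power_one_over)
  finally have "ennreal (1 / (t ^ CARD('n) * f ^ CARD('m))) * 1 <
      ennreal (1 / (t ^ CARD('n) * f ^ CARD('m))) * emeasure lborel (T -` A)" using gt by simp
  then have "1 < emeasure lborel (T -` A)"
    by (meson linorder_not_le mult_left_mono zero_le)
  then obtain x y where xy: "x \<in> T -` A" "y \<in> T -` A" "x \<noteq> y" "x - y \<in> integer_points"
    using blichfeldt_integer_points \<open>T -` A \<in> sets borel\<close> unfolding blichfeldt_bound_def by metis
  have "T x - T y = T (x - y)"
    by (simp add: T_def algebra_simps matrix_vector_mult_diff_distrib)
  moreover have "T (x - y) \<in> dual_lattice \<Theta> t f"
    using xy(4) by (cases "x - y") (auto simp: dual_lattice_def T_def integer_points_prod)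
  moreover have "T x \<noteq> T y"
  proof
    assume eq: "T x = T y"
    then have "fst x = fst y" using t by (auto simp: T_def)
    moreover from this eq have "snd x = snd y" using f by (auto simp: T_def)
    ultimately show False using xy(3) by (simp add: prod_eq_iff)
  qed
  ultimately show "\<exists>x\<in>A. \<exists>y\<in>A. x \<noteq> y \<and> x - y \<in> dual_lattice \<Theta> t f"
    using xy by (intro bexI[of _ "T x"] bexI[of _ "T y"]) auto
qed

section \<open>Planar densities\<close>

text \<open>\<open>ennreal\<close> cuts off negative values, so this is the volume under an elliptic
  paraboloid, exactly \<open>pi / 2 * r * s\<close>. The inner integral is \<open>4 / 3 * s\<close>
  times \<open>a x * sqrt (a x)\<close>; bounding the root by \<open>(1 + a x) / 2\<close> leaves a
  polynomial, and 8/5 is only slightly above pi/2.\<close>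

lemma nn_integral_paraboloid_le:
  fixes r s :: real
  assumes r: "r > 0" and s: "s > 0"
  shows "(\<integral>\<^sup>+y. ennreal (1 - (fst y)\<^sup>2 / r\<^sup>2 - (snd y)\<^sup>2 / s\<^sup>2) \<partial>(lborel :: (real \<times> real) measure))
    \<le> ennreal (8 / 5 * r * s)"
proof -
  define a where "a x = 1 - x\<^sup>2 / r\<^sup>2" for x
  have inner: "(\<integral>\<^sup>+y. ennreal (a x - y\<^sup>2 / s\<^sup>2) \<partial>lborel) \<le>
      ennreal (4 / 3 * s * (a x * (1 + a x) / 2)) * indicator {-r..r} x" for x
  proof (cases "a x \<le> 0")
    case True
    have "a x - y\<^sup>2 / s\<^sup>2 \<le> 0" for y using True by (smt (verit) zero_le_divide_iff zero_le_power2)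
    then show ?thesis by (simp add: ennreal_neg)
  next
    case False
    define q where "q = sqrt (a x)"
    have q: "q > 0" "q\<^sup>2 = a x" using False by (auto simp: q_def)
    have "x\<^sup>2 \<le> r\<^sup>2" using False r by (simp add: a_def field_simps)
    then have x: "x \<in> {-r..r}" using r by (simp add: abs_le_square_iff[symmetric] abs_le_iff)
    let ?F = "\<lambda>y. a x * y - y ^ 3 / (3 * s\<^sup>2)"
    have "(\<integral>\<^sup>+y. ennreal (a x - y\<^sup>2 / s\<^sup>2) \<partial>lborel) =
        (\<integral>\<^sup>+y. ennreal (a x - y\<^sup>2 / s\<^sup>2) * indicator {- (s * q)..s * q} y \<partial>lborel)"
    proof (intro nn_integral_cong)
      fix y :: real
      show "ennreal (a x - y\<^sup>2 / s\<^sup>2) = ennreal (a x - y\<^sup>2 / s\<^sup>2) * indicator {- (s * q)..s * q} y"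
      proof (cases "y \<in> {- (s * q)..s * q}")
        case False
        then have "\<bar>s * q\<bar> \<le> \<bar>y\<bar>" using s q by auto
        then have "(s * q)\<^sup>2 \<le> y\<^sup>2" by (simp add: abs_le_square_iff)
        then have "a x - y\<^sup>2 / s\<^sup>2 \<le> 0" using s q by (simp add: power_mult_distrib field_simps)
        then show ?thesis using False by (simp add: ennreal_neg)
      qed simp
    qed
    also have "\<dots> = ennreal (?F (s * q) - ?F (- (s * q)))"
    proof (rule nn_integral_FTC_Icc)
      fix y assume y: "y \<in> {- (s * q)..s * q}"
      show "(?F has_real_derivative a x - y\<^sup>2 / s\<^sup>2) (at y)"
        using s by (auto intro!: derivative_eq_intros simp: field_simps)
      have "y\<^sup>2 \<le> (s * q)\<^sup>2" using y by (intro iffD1[OF abs_le_square_iff]) auto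
      then show "0 \<le> a x - y\<^sup>2 / s\<^sup>2" using s q by (simp add: power_mult_distrib field_simps)
    qed (use s q in auto)
    also have "?F (s * q) - ?F (- (s * q)) = 4 / 3 * s * (a x * q)"
      using s unfolding q(2)[symmetric] by (simp add: field_simps power3_eq_cube power2_eq_square)
    also have "\<dots> \<le> 4 / 3 * s * (a x * (1 + a x) / 2)"
    proof -
      have "0 \<le> (1 - q)\<^sup>2" by simp
      then have "q \<le> (1 + a x) / 2" unfolding q(2)[symmetric] by (simp add: power2_eq_square algebra_simps)
      then have "a x * q \<le> a x * ((1 + a x) / 2)" using False by (intro mult_left_mono) auto
      then have "4 / 3 * s * (a x * q) \<le> 4 / 3 * s * (a x * ((1 + a x) / 2))"
        by (rule mult_left_mono) (use s in simp)
      then show ?thesis by simp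
    qed
    finally show ?thesis using x by (simp add: ennreal_leI)
  qed
  let ?G = "\<lambda>x. 4 / 3 * s * (x - x ^ 3 / (2 * r\<^sup>2) + x ^ 5 / (10 * r ^ 4))"
  have "(\<integral>\<^sup>+y. ennreal (1 - (fst y)\<^sup>2 / r\<^sup>2 - (snd y)\<^sup>2 / s\<^sup>2) \<partial>(lborel :: (real \<times> real) measure)) =
      (\<integral>\<^sup>+x. (\<integral>\<^sup>+y. ennreal (1 - x\<^sup>2 / r\<^sup>2 - y\<^sup>2 / s\<^sup>2) \<partial>lborel) \<partial>lborel)"
    unfolding lborel_prod[symmetric] by (subst lborel.nn_integral_fst[symmetric]) auto
  also have "\<dots> \<le> (\<integral>\<^sup>+x. ennreal (4 / 3 * s * (a x * (1 + a x) / 2)) * indicator {-r..r} x \<partial>lborel)"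
    using inner by (intro nn_integral_mono) (simp add: a_def)
  also have "\<dots> = ennreal (?G r - ?G (- r))"
  proof (rule nn_integral_FTC_Icc)
    fix x assume x: "x \<in> {- r..r}"
    show "(?G has_real_derivative 4 / 3 * s * (a x * (1 + a x) / 2)) (at x)"
      using r by (auto intro!: derivative_eq_intros simp: a_def field_simps power2_eq_square power4_eq_xxxx)
    have "x\<^sup>2 \<le> r\<^sup>2" using x by (intro iffD1[OF abs_le_square_iff]) auto
    then have "0 \<le> a x" using r by (simp add: a_def)
    then show "0 \<le> 4 / 3 * s * (a x * (1 + a x) / 2)" using s by simp
  qed (use r in \<open>auto simp: a_def\<close>)
  also have "?G r - ?G (- r) = 8 / 5 * r * s"
    using r by (simp add: field_simps eval_nat_numeral)
  finally show ?thesis .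
qed

text \<open>Averaging the mass of small squares against the weight \<open>(1 - y\<^sub>1\<^sup>2/r\<^sub>1\<^sup>2 - y\<^sub>2\<^sup>2/r\<^sub>2\<^sup>2)\<^sub>+\<close>
  bounds the maximal planar density by the variances alone. This replaces Vaaler's theorem on
  cube sections: in dimension at least 3 the constant \<open>sqrt (2 d (d - 1))\<close> leaves enough room.\<close>

lemma planar_density:
  fixes v w :: "'a::euclidean_space" and a b c :: real
  assumes dim: "DIM('a) \<ge> 3" and a: "a > 0" and b: "b > 0"
    and v: "(norm v)\<^sup>2 \<le> DIM('a) * a\<^sup>2" and w: "(norm w)\<^sup>2 \<le> DIM('a) * b\<^sup>2"
    and c: "c = sqrt (2 * real DIM('a) * (real DIM('a) - 1))"
  obtains N :: nat and y z where "N > 0"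
    "ennreal (1 / (c * a * b)) < of_nat N * (of_nat N *
       emeasure lborel {\<xi>\<in>half_cube. \<bar>\<xi> \<bullet> v - y\<bar> < 1 / (2 * real N) \<and> \<bar>\<xi> \<bullet> w - z\<bar> < 1 / (2 * real N)})"
proof -
  define d where "d = real DIM('a)"
  have d: "d \<ge> 3" using dim by (simp add: d_def)
  have c': "c = sqrt (2 * d * (d - 1))" by (simp add: c d_def)
  have c2: "c\<^sup>2 = 2 * d * (d - 1)" using d by (simp add: c')
  \<comment> \<open>Here dimension at least 3 enters: c^2 = 2 d (d - 1) is at least 4/3 d^2, and
    (23/20)^2 < 4/3.\<close>
  have "(23 / 20 * d)\<^sup>2 \<le> c\<^sup>2"
  proof -
    have "0 \<le> d * (d - 3)" using d by simp
    then have "4 * d\<^sup>2 \<le> 3 * (2 * d * (d - 1))" by (simp add: power2_eq_square algebra_simps)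
    moreover have "3 * (23 / 20 * d)\<^sup>2 \<le> 4 * d\<^sup>2" by (simp add: power_mult_distrib power2_eq_square)
    ultimately show ?thesis by (simp add: c2)
  qed
  then have cd: "23 / 20 * d \<le> c" by (rule power2_le_imp_le) (use d in \<open>simp add: c'\<close>)
  then have cpos: "c > 0" using d by linarith
  \<comment> \<open>The variance of \<open>\<xi> \<bullet> v\<close> is at most
    \<open>d * a\<^sup>2 / 12\<close>, and \<open>r\<^sup>2\<close> is four times that: then the
    weight has mean at least 1/2, and (1 - 2 x) x, with x the ratio of variance bound to
    \<open>r\<^sup>2\<close>, is maximal at x = 1/4.\<close>
  define r s where "r = a * sqrt (d / 3)" and "s = b * sqrt (d / 3)"
  have "r * s = a * b * (sqrt (d / 3))\<^sup>2" by (simp only: r_def s_def power2_eq_square mult_ac)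
  also have "\<dots> = d * a * b / 3" using d by simp
  finally have rs: "r > 0" "s > 0" "r\<^sup>2 = d * a\<^sup>2 / 3" "s\<^sup>2 = d * b\<^sup>2 / 3" "r * s = d * a * b / 3"
    using a b d by (auto simp: r_def s_def power_mult_distrib)
  define K where "K = 1 / (c * a * b)"
  have K: "K > 0" using cpos a b by (simp add: K_def)
  \<comment> \<open>2100 = 21 * 100: the error
    \<open>21 * \<delta>\<^sup>2 * (1 / r\<^sup>2 + 1 / s\<^sup>2)\<close> caused by the size of the
    squares becomes at most 1/100.\<close>
  obtain N :: nat where N2: "2100 * (1 / r\<^sup>2 + 1 / s\<^sup>2) < real N"
    using reals_Archimedean2 by blast
  have "0 < 2100 * (1 / r\<^sup>2 + 1 / s\<^sup>2)" using rs by (simp add: add_pos_pos)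
  then have "0 < real N" using N2 by (rule less_trans)
  then have N: "N > 0" by simp
  define \<delta> where "\<delta> = 1 / (2 * real N)"
  have \<delta>: "\<delta> > 0" using N by (simp add: \<delta>_def)
  define E where "E y = emeasure lborel {\<xi>\<in>half_cube. \<bar>\<xi> \<bullet> v - fst y\<bar> < \<delta> \<and> \<bar>\<xi> \<bullet> w - snd y\<bar> < \<delta>}"
    for y :: "real \<times> real"
  have "\<exists>y. ennreal K < of_nat N * (of_nat N * E y)"
  proof (rule ccontr)
    assume "\<not> ?thesis"
    \<comment> \<open>As \<open>1 / N = 2 * \<delta>\<close>, the negation says that every square of
      side \<open>2 * \<delta>\<close> has mass at most \<open>K\<close> times its area.\<close>
    then have le: "of_nat N * (of_nat N * E y) \<le> ennreal K" for y by (meson not_less)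
    define h :: "'a \<Rightarrow> real \<times> real \<Rightarrow> ennreal" where
      "h \<xi> y = indicator {\<xi>\<in>half_cube. \<bar>\<xi> \<bullet> v - fst y\<bar> < \<delta> \<and> \<bar>\<xi> \<bullet> w - snd y\<bar> < \<delta>} \<xi>" for \<xi> y
    have h_alt: "h \<xi> y = indicator half_cube \<xi> *
        indicator ({\<xi> \<bullet> v - \<delta><..<\<xi> \<bullet> v + \<delta>} \<times> {\<xi> \<bullet> w - \<delta><..<\<xi> \<bullet> w + \<delta>}) y" for \<xi> y
      by (cases y) (auto simp: h_def indicator_def abs_less_iff)
    have h_meas[measurable]: "(\<lambda>(\<xi>, y). h \<xi> y) \<in> borel_measurable (lborel \<Otimes>\<^sub>M lborel)"
      unfolding h_def lborel_prod[symmetric] split_beta' indicator_def by measurable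
    have h_meas'[measurable]: "h \<xi> \<in> borel_measurable lborel" for \<xi>
      unfolding h_def[abs_def] lborel_prod[symmetric] indicator_def by measurable
    have h_meas''[measurable]: "(\<lambda>\<xi>. h \<xi> y) \<in> borel_measurable lborel" for y
      unfolding h_def indicator_def by measurable
    have box: "(\<integral>\<^sup>+y. h \<xi> y \<partial>lborel) = indicator half_cube \<xi> * ennreal (4 * \<delta>\<^sup>2)" for \<xi>
    proof -
      have "(\<integral>\<^sup>+y. h \<xi> y \<partial>lborel) = indicator half_cube \<xi> *
          emeasure (lborel \<Otimes>\<^sub>M lborel) ({\<xi> \<bullet> v - \<delta><..<\<xi> \<bullet> v + \<delta>} \<times> {\<xi> \<bullet> w - \<delta><..<\<xi> \<bullet> w + \<delta>})"
        unfolding h_alt lborel_prod[symmetric]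
        by (subst nn_integral_cmult) auto
      also have "\<dots> = indicator half_cube \<xi> * ennreal (4 * \<delta>\<^sup>2)"
        using \<delta> by (subst lborel.emeasure_pair_measure_Times)
          (auto simp: ennreal_mult[symmetric] power2_eq_square)
      finally show ?thesis .
    qed
    define g where "g y = ennreal (1 - (fst y)\<^sup>2 / r\<^sup>2 - (snd y)\<^sup>2 / s\<^sup>2)" for y :: "real \<times> real"
    have g_meas[measurable]: "g \<in> borel_measurable lborel"
      unfolding g_def[abs_def] lborel_prod[symmetric] by measurable
    \<comment> \<open>An upper bound for \<open>1 - g y\<close> at all \<open>y\<close> within
      \<open>\<delta>\<close> of the image of \<open>\<xi>\<close>, from (x + e)^2 <= (1 + 1/20) x^2
      + (1 + 20) e^2.\<close>
    define Q where "Q \<xi> = 21 / 20 * ((\<xi> \<bullet> v)\<^sup>2 / r\<^sup>2 + (\<xi> \<bullet> w)\<^sup>2 / s\<^sup>2) + 21 * \<delta>\<^sup>2 * (1 / r\<^sup>2 + 1 / s\<^sup>2)" for \<xi>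
    have Q0: "Q \<xi> \<ge> 0" for \<xi> by (simp add: Q_def)
    have [measurable]: "Q \<in> borel_measurable borel" unfolding Q_def[abs_def] by measurable
    have near: "y\<^sup>2 \<le> 21 / 20 * x\<^sup>2 + 21 * \<delta>\<^sup>2" if "\<bar>x - y\<bar> < \<delta>" for x y :: real
    proof -
      have "(y - x)\<^sup>2 \<le> \<delta>\<^sup>2" using that \<delta> by (intro iffD1[OF abs_le_square_iff]) auto
      moreover have "0 \<le> (x - 20 * (y - x))\<^sup>2" by simp
      then have "40 * x * (y - x) \<le> x\<^sup>2 + 400 * (y - x)\<^sup>2"
        by (simp add: power2_eq_square algebra_simps)
      moreover have "y\<^sup>2 = x\<^sup>2 + 2 * x * (y - x) + (y - x)\<^sup>2" by (simp add: power2_eq_square algebra_simps)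
      ultimately show ?thesis by linarith
    qed
    have pt: "h \<xi> y \<le> h \<xi> y * g y + h \<xi> y * ennreal (Q \<xi>)" for \<xi> y
    proof (cases "\<xi> \<in> half_cube \<and> \<bar>\<xi> \<bullet> v - fst y\<bar> < \<delta> \<and> \<bar>\<xi> \<bullet> w - snd y\<bar> < \<delta>")
      case True
      have "(fst y)\<^sup>2 / r\<^sup>2 \<le> (21 / 20 * (\<xi> \<bullet> v)\<^sup>2 + 21 * \<delta>\<^sup>2) / r\<^sup>2"
        "(snd y)\<^sup>2 / s\<^sup>2 \<le> (21 / 20 * (\<xi> \<bullet> w)\<^sup>2 + 21 * \<delta>\<^sup>2) / s\<^sup>2"
        using True near by (auto intro!: divide_right_mono)
      then have "1 \<le> (1 - (fst y)\<^sup>2 / r\<^sup>2 - (snd y)\<^sup>2 / s\<^sup>2) + Q \<xi>"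
        by (simp add: Q_def add_divide_distrib algebra_simps)
      then have "ennreal 1 \<le> ennreal ((1 - (fst y)\<^sup>2 / r\<^sup>2 - (snd y)\<^sup>2 / s\<^sup>2) + Q \<xi>)" by (rule ennreal_leI)
      also have "\<dots> \<le> g y + ennreal (Q \<xi>)"
      proof (cases "1 - (fst y)\<^sup>2 / r\<^sup>2 - (snd y)\<^sup>2 / s\<^sup>2 \<ge> 0")
        case True
        then show ?thesis using Q0 by (simp add: g_def ennreal_plus[symmetric] del: ennreal_plus)
      next
        case False
        then have "ennreal ((1 - (fst y)\<^sup>2 / r\<^sup>2 - (snd y)\<^sup>2 / s\<^sup>2) + Q \<xi>) \<le> ennreal (Q \<xi>)"
          by (intro ennreal_leI) simp
        then show ?thesis by (meson add_increasing order_trans zero_le)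
      qed
      finally show ?thesis using True by (simp add: h_def)
    qed (simp add: h_def)
    \<comment> \<open>The area of a square, averaged over \<open>\<xi>\<close>, is split by
      \<open>pt\<close>. The \<open>g\<close> part is bounded by the assumed density after
      exchanging the integrals, the \<open>Q\<close> part by the variances.\<close>
    have "ennreal (4 * \<delta>\<^sup>2) = (\<integral>\<^sup>+\<xi>. indicator half_cube \<xi> * ennreal (4 * \<delta>\<^sup>2) \<partial>(lborel :: 'a measure))"
      by (subst nn_integral_multc) (auto simp: emeasure_half_cube)
    also have "\<dots> = (\<integral>\<^sup>+\<xi>. (\<integral>\<^sup>+y. h \<xi> y \<partial>lborel) \<partial>lborel)" by (simp add: box)
    also have "\<dots> \<le> (\<integral>\<^sup>+\<xi>. (\<integral>\<^sup>+y. h \<xi> y * g y + h \<xi> y * ennreal (Q \<xi>) \<partial>lborel) \<partial>lborel)"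
      by (intro nn_integral_mono pt)
    also have "\<dots> = (\<integral>\<^sup>+\<xi>. (\<integral>\<^sup>+y. h \<xi> y * g y \<partial>lborel) + (\<integral>\<^sup>+y. h \<xi> y * ennreal (Q \<xi>) \<partial>lborel) \<partial>lborel)"
      by (intro nn_integral_cong nn_integral_add) measurable
    also have "\<dots> = (\<integral>\<^sup>+\<xi>. (\<integral>\<^sup>+y. h \<xi> y * g y \<partial>lborel) \<partial>lborel) +
        (\<integral>\<^sup>+\<xi>. (\<integral>\<^sup>+y. h \<xi> y * ennreal (Q \<xi>) \<partial>lborel) \<partial>lborel)"
      by (rule nn_integral_add) measurable
    also have "(\<integral>\<^sup>+\<xi>. (\<integral>\<^sup>+y. h \<xi> y * g y \<partial>lborel) \<partial>lborel) = (\<integral>\<^sup>+y. (\<integral>\<^sup>+\<xi>. h \<xi> y * g y \<partial>lborel) \<partial>lborel)"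
      by (rule lborel_pair.Fubini') measurable
    also have "\<dots> = (\<integral>\<^sup>+y. E y * g y \<partial>lborel)"
    proof (intro nn_integral_cong)
      fix y
      have "(\<integral>\<^sup>+\<xi>. h \<xi> y * g y \<partial>lborel) = (\<integral>\<^sup>+\<xi>. h \<xi> y \<partial>lborel) * g y"
        by (rule nn_integral_multc) measurable
      also have "(\<integral>\<^sup>+\<xi>. h \<xi> y \<partial>lborel) = E y"
        unfolding h_def E_def by (rule nn_integral_indicator) measurable
      finally show "(\<integral>\<^sup>+\<xi>. h \<xi> y * g y \<partial>lborel) = E y * g y" .
    qed
    also have "\<dots> \<le> (\<integral>\<^sup>+y. ennreal (4 * \<delta>\<^sup>2 * K) * g y \<partial>lborel)"
    proof (intro nn_integral_mono mult_right_mono)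
      fix y
      have "E y = ennreal (4 * \<delta>\<^sup>2) * (of_nat N * (of_nat N * E y))"
        using N by (simp add: \<delta>_def power2_eq_square ennreal_of_nat_eq_real_of_nat mult.assoc[symmetric]
            ennreal_mult[symmetric])
      also have "\<dots> \<le> ennreal (4 * \<delta>\<^sup>2) * ennreal K" by (intro mult_left_mono le) simp
      finally show "E y \<le> ennreal (4 * \<delta>\<^sup>2 * K)" using K by (simp add: ennreal_mult[symmetric])
    qed simp
    also have "\<dots> = ennreal (4 * \<delta>\<^sup>2 * K) * (\<integral>\<^sup>+y. g y \<partial>lborel)" by (rule nn_integral_cmult) measurable
    also have "\<dots> \<le> ennreal (4 * \<delta>\<^sup>2 * K) * ennreal (8 / 5 * r * s)"
      unfolding g_def by (intro mult_left_mono nn_integral_paraboloid_le rs) simp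
    also have "\<dots> = ennreal (4 * \<delta>\<^sup>2 * K * (8 / 5 * r * s))"
      using K rs by (intro ennreal_mult[symmetric]) auto
    also have "(\<integral>\<^sup>+\<xi>. (\<integral>\<^sup>+y. h \<xi> y * ennreal (Q \<xi>) \<partial>lborel) \<partial>lborel) =
        (\<integral>\<^sup>+\<xi>. indicator half_cube \<xi> * ennreal (4 * \<delta>\<^sup>2) * ennreal (Q \<xi>) \<partial>lborel)"
      by (intro nn_integral_cong, subst nn_integral_multc) (auto simp: box)
    also have "\<dots> = (\<integral>\<^sup>+\<xi>. ennreal (4 * \<delta>\<^sup>2) * (ennreal (21 / 20 / r\<^sup>2) * (indicator half_cube \<xi> * ennreal ((\<xi> \<bullet> v)\<^sup>2)) +
         ennreal (21 / 20 / s\<^sup>2) * (indicator half_cube \<xi> * ennreal ((\<xi> \<bullet> w)\<^sup>2)) +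
         ennreal (21 * \<delta>\<^sup>2 * (1 / r\<^sup>2 + 1 / s\<^sup>2)) * indicator half_cube \<xi>) \<partial>lborel)"
    proof (intro nn_integral_cong)
      fix \<xi> :: 'a
      have "ennreal (Q \<xi>) = ennreal (21 / 20 / r\<^sup>2) * ennreal ((\<xi> \<bullet> v)\<^sup>2) +
         ennreal (21 / 20 / s\<^sup>2) * ennreal ((\<xi> \<bullet> w)\<^sup>2) + ennreal (21 * \<delta>\<^sup>2 * (1 / r\<^sup>2 + 1 / s\<^sup>2))"
        by (simp add: Q_def ennreal_mult[symmetric] ennreal_plus[symmetric] algebra_simps del: ennreal_plus)
      then show "indicator half_cube \<xi> * ennreal (4 * \<delta>\<^sup>2) * ennreal (Q \<xi>) =
        ennreal (4 * \<delta>\<^sup>2) * (ennreal (21 / 20 / r\<^sup>2) * (indicator half_cube \<xi> * ennreal ((\<xi> \<bullet> v)\<^sup>2)) +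
         ennreal (21 / 20 / s\<^sup>2) * (indicator half_cube \<xi> * ennreal ((\<xi> \<bullet> w)\<^sup>2)) +
         ennreal (21 * \<delta>\<^sup>2 * (1 / r\<^sup>2 + 1 / s\<^sup>2)) * indicator half_cube \<xi>)"
        by (simp add: indicator_def)
    qed
    also have "\<dots> = ennreal (4 * \<delta>\<^sup>2) * (ennreal (21 / 20 / r\<^sup>2) * ennreal ((norm v)\<^sup>2 / 12) +
         ennreal (21 / 20 / s\<^sup>2) * ennreal ((norm w)\<^sup>2 / 12) + ennreal (21 * \<delta>\<^sup>2 * (1 / r\<^sup>2 + 1 / s\<^sup>2)))"
      by (simp add: nn_integral_cmult nn_integral_add nn_integral_half_cube_square emeasure_half_cube)
    also have "\<dots> = ennreal (4 * \<delta>\<^sup>2 * (21 / 20 / r\<^sup>2 * ((norm v)\<^sup>2 / 12) + 21 / 20 / s\<^sup>2 * ((norm w)\<^sup>2 / 12) +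
         21 * \<delta>\<^sup>2 * (1 / r\<^sup>2 + 1 / s\<^sup>2)))"
      by (simp add: ennreal_mult[symmetric] ennreal_plus[symmetric] del: ennreal_plus)
    finally have "ennreal (4 * \<delta>\<^sup>2) \<le> ennreal (4 * \<delta>\<^sup>2 * K * (8 / 5 * r * s)) +
        ennreal (4 * \<delta>\<^sup>2 * (21 / 20 / r\<^sup>2 * ((norm v)\<^sup>2 / 12) + 21 / 20 / s\<^sup>2 * ((norm w)\<^sup>2 / 12) +
         21 * \<delta>\<^sup>2 * (1 / r\<^sup>2 + 1 / s\<^sup>2)))"
      \<comment> \<open>The first summand was estimated inside a sum; the monotonicity of addition
        owed by the calculation is supplied here.\<close>
      by this (rule add_right_mono, assumption)+
    also have "\<dots> = ennreal (4 * \<delta>\<^sup>2 * K * (8 / 5 * r * s) +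
        4 * \<delta>\<^sup>2 * (21 / 20 / r\<^sup>2 * ((norm v)\<^sup>2 / 12) + 21 / 20 / s\<^sup>2 * ((norm w)\<^sup>2 / 12) +
         21 * \<delta>\<^sup>2 * (1 / r\<^sup>2 + 1 / s\<^sup>2)))"
      using K rs(1,2) by (intro ennreal_plus[symmetric]) auto
    finally have "4 * \<delta>\<^sup>2 \<le> 4 * \<delta>\<^sup>2 * K * (8 / 5 * r * s) +
        4 * \<delta>\<^sup>2 * (21 / 20 / r\<^sup>2 * ((norm v)\<^sup>2 / 12) + 21 / 20 / s\<^sup>2 * ((norm w)\<^sup>2 / 12) +
         21 * \<delta>\<^sup>2 * (1 / r\<^sup>2 + 1 / s\<^sup>2))"
      using K rs(1,2) by (subst (asm) ennreal_le_iff) auto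
    then have "4 * \<delta>\<^sup>2 * 1 \<le> 4 * \<delta>\<^sup>2 * (K * (8 / 5 * r * s) +
        (21 / 20 / r\<^sup>2 * ((norm v)\<^sup>2 / 12) + 21 / 20 / s\<^sup>2 * ((norm w)\<^sup>2 / 12) + 21 * \<delta>\<^sup>2 * (1 / r\<^sup>2 + 1 / s\<^sup>2)))"
      by (simp only: distrib_left mult.assoc mult_1_right)
    then have 1: "1 \<le> K * (8 / 5 * r * s) +
        (21 / 20 / r\<^sup>2 * ((norm v)\<^sup>2 / 12) + 21 / 20 / s\<^sup>2 * ((norm w)\<^sup>2 / 12) + 21 * \<delta>\<^sup>2 * (1 / r\<^sup>2 + 1 / s\<^sup>2))"
      using \<delta> by (subst (asm) mult_le_cancel_left_pos) auto
    have "21 / 20 / r\<^sup>2 * ((norm v)\<^sup>2 / 12) \<le> 21 / 20 / r\<^sup>2 * (d * a\<^sup>2 / 12)"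
      using v by (intro mult_left_mono divide_right_mono) (auto simp: d_def)
    also have "\<dots> = 21 / 80" using rs a d by (simp add: rs(3))
    finally have 2: "21 / 20 / r\<^sup>2 * ((norm v)\<^sup>2 / 12) \<le> 21 / 80" .
    have "21 / 20 / s\<^sup>2 * ((norm w)\<^sup>2 / 12) \<le> 21 / 20 / s\<^sup>2 * (d * b\<^sup>2 / 12)"
      using w by (intro mult_left_mono divide_right_mono) (auto simp: d_def)
    also have "\<dots> = 21 / 80" using rs b d by (simp add: rs(4))
    finally have 3: "21 / 20 / s\<^sup>2 * ((norm w)\<^sup>2 / 12) \<le> 21 / 80" .
    have "K * (8 / 5 * r * s) = K * (8 / 5 * (r * s))" by (simp only: mult.assoc)
    also have "\<dots> = 8 / 15 * (d / c)"
      unfolding rs(5) using a b cpos by (simp add: K_def field_simps)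
    also have "\<dots> \<le> 8 / 15 * (20 / 23)" using cd cpos by (simp add: field_simps)
    finally have 4: "K * (8 / 5 * r * s) \<le> 32 / 69" by simp
    have "21 * \<delta>\<^sup>2 * (1 / r\<^sup>2 + 1 / s\<^sup>2) \<le> 1 / 100"
    proof -
      have "\<delta> \<le> 1" using N by (simp add: \<delta>_def)
      then have "\<delta>\<^sup>2 \<le> \<delta>" using \<delta> by (simp add: power2_eq_square mult_left_le)
      also have "\<delta> \<le> 1 / real N" using N by (simp add: \<delta>_def field_simps)
      finally have "21 * \<delta>\<^sup>2 * (1 / r\<^sup>2 + 1 / s\<^sup>2) \<le> 21 * (1 / real N) * (1 / r\<^sup>2 + 1 / s\<^sup>2)"
        by (intro mult_right_mono mult_left_mono) auto
      also have "\<dots> = (2100 * (1 / r\<^sup>2 + 1 / s\<^sup>2)) / real N / 100"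
        using N by (simp add: divide_simps)
      also have "\<dots> \<le> 1 / 100"
        by (rule divide_right_mono) (use N N2 in \<open>simp_all add: divide_le_eq_1\<close>)
      finally show ?thesis .
    qed
    \<comment> \<open>32/69 + 21/80 + 21/80 + 1/100 is below 1 by about 0.0012, which is why 8/5,
      21/20 and 23/20 are chosen so tightly.\<close>
    then show False using 1 2 3 4 by linarith
  qed
  then show thesis using that[OF N] unfolding E_def \<delta>_def K_def by blast
qed

section \<open>Solutions of the dual system\<close>

definition form_vector :: "real ^ 'm ^ 'n \<Rightarrow> real \<Rightarrow> real \<Rightarrow> real ^ 'm \<Rightarrow> real ^ 'n \<Rightarrow> (real ^ 'n) \<times> (real ^ 'm)" where
  "form_vector \<Theta> t f x y = (t *\<^sub>R (\<Theta> *v x - y), - (f *\<^sub>R x))"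

text \<open>Nonzero only as a pair, as a nonzero lattice vector provides;
  \<open>p \<noteq> 0\<close> is derived at the very end from \<open>f < 1\<close>.\<close>

definition dual_solution :: "real ^ 'm ^ 'n \<Rightarrow> real \<Rightarrow> real \<Rightarrow> real ^ 'n \<Rightarrow> real ^ 'm \<Rightarrow> bool" where
  "dual_solution \<Theta> t f p q \<longleftrightarrow> integer_vector p \<and> integer_vector q \<and> (p \<noteq> 0 \<or> q \<noteq> 0) \<and>
     infnorm p \<le> t \<and> infnorm (transpose \<Theta> *v p - q) \<le> f"

lemma infnorm_le_iff: "infnorm (x :: 'a::euclidean_space) \<le> c \<longleftrightarrow> (\<forall>b\<in>Basis. \<bar>x \<bullet> b\<bar> \<le> c)"
  unfolding infnorm_Max by (subst Max_le_iff) auto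

lemma integer_vector_inner:
  assumes "integer_vector x" "integer_vector y"
  shows "x \<bullet> y \<in> \<int>"
  using assms by (auto simp: inner_vec_def integer_vector_def intro!: Ints_sum Ints_mult)

text \<open>The scalings by \<open>t\<close> and \<open>f\<close> cancel, and so do the two terms
  \<open>p \<bullet> (\<Theta> *v x)\<close>, owing to the minus sign in \<open>form_vector\<close>;
  what remains is \<open>q \<bullet> x - p \<bullet> y\<close>.\<close>

lemma dual_lattice_form_vector_int:
  assumes k: "k \<in> dual_lattice \<Theta> t f" and xy: "integer_vector x" "integer_vector y" and tf: "t > 0" "f > 0"
  shows "k \<bullet> form_vector \<Theta> t f x y \<in> \<int>"
proof -
  obtain p q where k: "k = ((1 / t) *\<^sub>R p, (1 / f) *\<^sub>R (transpose \<Theta> *v p - q))"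
    and pq: "integer_vector p" "integer_vector q"
    using k by (auto simp: dual_lattice_def)
  have "k \<bullet> form_vector \<Theta> t f x y = p \<bullet> (\<Theta> *v x - y) - (transpose \<Theta> *v p - q) \<bullet> x"
    using tf by (simp add: k form_vector_def)
  also have "\<dots> = q \<bullet> x - p \<bullet> y"
    using dot_lmul_matrix[of p \<Theta> x] by (simp add: inner_diff_left inner_diff_right)
  finally show ?thesis using pq xy by (simp add: integer_vector_inner)
qed

lemma form_vector_bound:
  assumes "t > 0" "f > 0" "t * infnorm (\<Theta> *v x - y) \<le> W" "f * infnorm x \<le> W" "b \<in> Basis"
  shows "\<bar>form_vector \<Theta> t f x y \<bullet> b\<bar> \<le> W"
proof -
  have 1: "t * \<bar>(\<Theta> *v x - y) \<bullet> b\<bar> \<le> W" if "b \<in> Basis" for b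
    using Basis_le_infnorm[OF that, of "\<Theta> *v x - y"] assms
    by (meson mult_left_mono less_imp_le order_trans)
  have 2: "f * \<bar>x \<bullet> b\<bar> \<le> W" if "b \<in> Basis" for b
    using Basis_le_infnorm[OF that, of x] assms
    by (meson mult_left_mono less_imp_le order_trans)
  show ?thesis
    using assms(1,2,5) 1 2 by (auto simp: form_vector_def Basis_prod_def abs_mult)
qed

lemma dual_solution_of_difference:
  assumes L: "\<exists>x\<in>A. \<exists>y\<in>A. x \<noteq> y \<and> x - y \<in> dual_lattice \<Theta> t f" and A: "A \<subseteq> half_cube"
    and tf: "t > 0" "f > 0"
  shows "\<exists>p q. dual_solution \<Theta> t f p q"
proof -
  obtain x y where xy: "x \<in> A" "y \<in> A" "x \<noteq> y" "x - y \<in> dual_lattice \<Theta> t f" using L by blast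
  then obtain p q where k: "x - y = ((1 / t) *\<^sub>R p, (1 / f) *\<^sub>R (transpose \<Theta> *v p - q))"
    and pq: "integer_vector p" "integer_vector q"
    by (auto simp: dual_lattice_def)
  have b: "\<bar>(x - y) \<bullet> b\<bar> \<le> 1" if "b \<in> Basis" for b
  proof -
    have "\<bar>x \<bullet> b\<bar> \<le> 1/2" "\<bar>y \<bullet> b\<bar> \<le> 1/2" using xy A that by (auto simp: half_cube_def)
    then show ?thesis unfolding inner_diff_left by linarith
  qed
  have "\<bar>p \<bullet> b\<bar> \<le> t" if "b \<in> Basis" for b
    using b[of "(b, 0)"] that tf unfolding k by (simp add: Basis_prod_def abs_mult)
  then have "infnorm p \<le> t" by (simp add: infnorm_le_iff)
  moreover have "\<bar>(transpose \<Theta> *v p - q) \<bullet> b\<bar> \<le> f" if "b \<in> Basis" for b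
    using b[of "(0, b)"] that tf unfolding k by (simp add: Basis_prod_def abs_mult)
  then have "infnorm (transpose \<Theta> *v p - q) \<le> f" by (simp only: infnorm_le_iff) blast
  moreover have "p \<noteq> 0 \<or> q \<noteq> 0"
  proof (rule ccontr)
    assume "\<not> (p \<noteq> 0 \<or> q \<noteq> 0)"
    then have "x - y = 0" unfolding k by (simp add: prod_eq_iff)
    then show False using xy(3) by simp
  qed
  ultimately show ?thesis using pq by (auto simp: dual_solution_def)
qed

lemma DIM_form: "DIM((real ^ 'n) \<times> (real ^ 'm)) = CARD('n) + CARD('m)"
  by simp

lemma abs_diff_less_of_half:
  fixes p q r e :: real
  shows "\<bar>p - r\<bar> < 1 / (2 * e) \<Longrightarrow> \<bar>q - r\<bar> < 1 / (2 * e) \<Longrightarrow> \<bar>p - q\<bar> < 1 / e"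
proof -
  assume "\<bar>p - r\<bar> < 1 / (2 * e)" "\<bar>q - r\<bar> < 1 / (2 * e)"
  moreover define h where "h = 1 / (2 * e)"
  moreover have "1 / e = h + h" by (simp add: h_def)
  ultimately show "\<bar>p - q\<bar> < 1 / e" by linarith
qed

text \<open>In direction \<open>w\<close> the \<open>N\<close>-fold slab has volume at least
  \<open>Delta / (W * r)\<close> for some \<open>r > 1\<close>, against the covolume
  \<open>1 / D\<close>. The strict bound on \<open>W\<close> leaves room for \<open>r\<close>, the
  loss in \<open>Delta_slab\<close>.\<close>

lemma dual_solution_one_strict:
  fixes \<Theta> :: "real ^ 'm ^ 'n"
  assumes tf: "t > 0" "f > 0" and xy: "integer_vector x" "integer_vector y" and x: "x \<noteq> 0"
    and W: "W < Delta TYPE('n + 'm) * t ^ CARD('n) * f ^ CARD('m)"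
    and bound: "t * infnorm (\<Theta> *v x - y) \<le> W" "f * infnorm x \<le> W"
  shows "\<exists>p q. dual_solution \<Theta> t f p q"
proof -
  define w where "w = form_vector \<Theta> t f x y"
  define D where "D = t ^ CARD('n) * f ^ CARD('m)"
  have D: "D > 0" using tf by (simp add: D_def)
  have W0: "W > 0"
    using bound(2) tf x by (smt (verit) infnorm_pos_lt mult_pos_pos)
  have wb: "\<bar>w \<bullet> b\<bar> \<le> W" if "b \<in> Basis" for b
    unfolding w_def by (rule form_vector_bound[OF tf bound that])
  have w0: "w \<noteq> 0" using x tf by (auto simp: w_def form_vector_def zero_prod_def)
  define \<Delta> where "\<Delta> = Delta TYPE('n + 'm)"
  have "1 < \<Delta> * D / W" using W W0 by (simp add: \<Delta>_def D_def mult.assoc)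
  then obtain r where r: "1 < r" "r < \<Delta> * D / W" using dense by blast
  define l where "l = root CARD('n + 'm) r"
  have l: "l > 1" "l ^ CARD('n + 'm) = r" using r by (auto simp: l_def)
  obtain \<delta>0 where \<delta>0: "\<delta>0 > 0" "\<And>\<delta>. 0 < \<delta> \<and> \<delta> < \<delta>0 \<Longrightarrow> ennreal (2 * \<delta> * \<Delta> / r) \<le>
        emeasure lborel {\<xi>\<in>half_cube. \<bar>\<xi> \<bullet> (One :: real ^ ('n + 'm))\<bar> < \<delta>}"
    using Delta_slab(2)[OF l(1), where 'k="'n + 'm"] unfolding l(2) \<Delta>_def by blast
  obtain N :: nat where N1: "1 / (2 * W * \<delta>0) < real N" using reals_Archimedean2 by blast
  have "0 < 1 / (2 * W * \<delta>0)" using W0 \<delta>0 by simp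
  then have N: "N > 0" using N1 by (metis less_trans of_nat_0_less_iff)
  \<comment> \<open>Then \<open>\<bar>\<xi> \<bullet> w\<bar> < 1 / (2 * N)\<close> on the slab
    \<open>A\<close>, and \<open>N * (2 * \<delta>) = 1 / W\<close>.\<close>
  define \<delta> where "\<delta> = 1 / (2 * W * real N)"
  have \<delta>: "0 < \<delta>" "\<delta> < \<delta>0" using W0 N N1 \<delta>0 by (auto simp: \<delta>_def field_simps)
  define A where "A = {\<xi>\<in>half_cube. \<bar>\<xi> \<bullet> ((1 / W) *\<^sub>R w)\<bar> < \<delta>}"
  have A_w: "\<bar>\<xi> \<bullet> w\<bar> < 1 / (2 * real N)" if "\<xi> \<in> A" for \<xi>
    using that W0 N by (auto simp: A_def \<delta>_def field_simps)
  have "ennreal (2 * \<delta> * \<Delta> / r) \<le> emeasure lborel {\<xi>\<in>half_cube. \<bar>\<xi> \<bullet> (One :: real ^ ('n + 'm))\<bar> < \<delta>}"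
    using \<delta>0(2) \<delta> by blast
  also have "\<dots> \<le> emeasure lborel A"
    unfolding A_def
  proof (rule slab_measure_antimono)
    fix b :: "(real ^ 'n) \<times> (real ^ 'm)" assume "b \<in> Basis"
    then show "\<bar>((1 / W) *\<^sub>R w) \<bullet> b\<bar> \<le> 1" using wb W0 by (simp add: abs_mult)
  qed simp
  finally have ge: "ennreal (2 * \<delta> * \<Delta> / r) \<le> emeasure lborel A" .
  have "1 / D < real N * (2 * \<delta> * \<Delta> / r)"
  proof -
    have "real N * (2 * \<delta> * \<Delta> / r) = \<Delta> / (W * r)" using N by (simp add: \<delta>_def)
    moreover have "1 / D < \<Delta> / (W * r)" using r W0 D by (simp add: field_simps)
    ultimately show ?thesis by simp
  qed
  then have "ennreal (1 / D) < ennreal (real N * (2 * \<delta> * \<Delta> / r))"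
    using D by (intro ennreal_lessI) (auto intro: less_trans[rotated])
  also have "\<dots> = of_nat N * ennreal (2 * \<delta> * \<Delta> / r)"
    unfolding ennreal_of_nat_eq_real_of_nat by (intro ennreal_mult') simp
  also have "\<dots> \<le> of_nat N * emeasure lborel A" by (intro mult_left_mono ge) simp
  finally have C: "ennreal (1 / D) < of_nat N * emeasure lborel A" .
  have "\<exists>x\<in>A. \<exists>y\<in>A. x \<noteq> y \<and> x - y \<in> dual_lattice \<Theta> t f"
  proof (rule lattice_difference_orthogonal[OF blichfeldt_dual_lattice[OF tf] _ w0 _ N])
    show "A \<in> sets borel" unfolding A_def by measurable
    show "\<bar>(x - y) \<bullet> w\<bar> < 1 / real N" if "x \<in> A" "y \<in> A" for x y
      using abs_diff_less_of_half[of "x \<bullet> w" 0 "real N" "y \<bullet> w"] A_w that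
      by (simp add: inner_diff_left)
    show "ennreal (1 / (t ^ CARD('n) * f ^ CARD('m))) < of_nat N * emeasure lborel A"
      using C by (simp add: D_def)
    show "k \<bullet> w \<in> \<int>" if "k \<in> dual_lattice \<Theta> t f" for k
      unfolding w_def by (rule dual_lattice_form_vector_int[OF that xy tf])
  qed
  then show ?thesis by (rule dual_solution_of_difference) (use tf in \<open>auto simp: A_def\<close>)
qed

section \<open>Finiteness of the candidates and the non-strict bound\<close>

lemma finite_integer_vectors: "finite {p :: real ^ 'n. integer_vector p \<and> infnorm p \<le> C}"
proof (rule finite_subset[OF _ finite_bounded_integer_points[of C]])
  show "{p :: real ^ 'n. integer_vector p \<and> infnorm p \<le> C} \<subseteq> {k \<in> integer_points. \<forall>b\<in>Basis. \<bar>k \<bullet> b\<bar> \<le> C}"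
    by (auto simp: integer_points_def integer_vector_def Basis_vec_def inner_axis infnorm_le_iff)
qed

lemma finite_integer_solutions:
  fixes M :: "real ^ 'n ^ 'm"
  shows "finite {(p, q). integer_vector p \<and> integer_vector q \<and> infnorm p \<le> B \<and> infnorm (M *v p - q) \<le> C}"
proof (rule finite_subset)
  let ?P = "{p :: real ^ 'n. integer_vector p \<and> infnorm p \<le> B}"
  show "{(p, q). integer_vector p \<and> integer_vector q \<and> infnorm p \<le> B \<and> infnorm (M *v p - q) \<le> C} \<subseteq>
      Sigma ?P (\<lambda>p. {q. integer_vector q \<and> infnorm q \<le> infnorm (M *v p) + C})"
  proof (clarsimp)
    fix p q assume "infnorm (M *v p - q) \<le> C"
    moreover have "infnorm q \<le> infnorm (M *v p) + infnorm (M *v p - q)"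
      using infnorm_triangle[of "M *v p" "q - M *v p"] by (simp add: infnorm_sub)
    ultimately show "infnorm q \<le> infnorm (M *v p) + C" by simp
  qed
  show "finite (Sigma ?P (\<lambda>p. {q. integer_vector q \<and> infnorm q \<le> infnorm (M *v p) + C}))"
    by (intro finite_SigmaI finite_integer_vectors)
qed

text \<open>Replacing \<open>t\<close>, \<open>f\<close> by \<open>s * t\<close>,
  \<open>s * f\<close> with \<open>s > 1\<close> multiplies the left sides by \<open>s\<close> and
  the right sides by \<open>s\<close> to the power d, where d is at least 2, so the bound becomes
  strict. Solutions for \<open>s \<le> 2\<close> lie in a finite set, and the best one works for
  \<open>s = 1\<close>.\<close>

lemma dual_solution_one:
  fixes \<Theta> :: "real ^ 'm ^ 'n"
  assumes tf: "t > 0" "f > 0" and xy: "integer_vector x" "integer_vector y" and x: "x \<noteq> 0"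
    and bound: "t * infnorm (\<Theta> *v x - y) \<le> Delta TYPE('n + 'm) * t ^ CARD('n) * f ^ CARD('m)"
      "f * infnorm x \<le> Delta TYPE('n + 'm) * t ^ CARD('n) * f ^ CARD('m)"
  shows "\<exists>p q. dual_solution \<Theta> t f p q"
proof -
  define W where "W = Delta TYPE('n + 'm) * t ^ CARD('n) * f ^ CARD('m)"
  have W0: "W > 0" using tf Delta_slab(1)[where 'k="'n + 'm", of 2] by (simp add: W_def)
  have ex: "\<exists>p q. dual_solution \<Theta> (s * t) (s * f) p q" if s: "s > 1" for s
  proof (rule dual_solution_one_strict[OF _ _ xy x])
    show "s * t > 0" "s * f > 0" using s tf by auto
    show "s * t * infnorm (\<Theta> *v x - y) \<le> s * W" "s * f * infnorm x \<le> s * W"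
      using bound s by (auto simp: W_def mult.assoc)
    have "CARD('n) + CARD('m) > 1"
      using zero_less_card_finite[where 'a='n] zero_less_card_finite[where 'a='m] by linarith
    then have "s ^ 1 < s ^ (CARD('n) + CARD('m))" using s by (intro power_strict_increasing) auto
    then have "s * W < s ^ (CARD('n) + CARD('m)) * W" using W0 by simp
    also have "\<dots> = Delta TYPE('n + 'm) * (s * t) ^ CARD('n) * (s * f) ^ CARD('m)"
      by (simp add: W_def power_mult_distrib power_add mult_ac)
    finally show "s * W < Delta TYPE('n + 'm) * (s * t) ^ CARD('n) * (s * f) ^ CARD('m)" .
  qed
  define F where "F = {(p, q). integer_vector p \<and> integer_vector q \<and> infnorm p \<le> 2 * t \<and>
      infnorm (transpose \<Theta> *v p - q) \<le> 2 * f} - {(0, 0)}"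
  have fin: "finite F" unfolding F_def by (intro finite_Diff finite_integer_solutions)
  \<comment> \<open>The least \<open>s\<close> for which the pair meets the bounds
    \<open>s * t\<close> and \<open>s * f\<close>.\<close>
  define g where "g = (\<lambda>(p, q). max (infnorm p / t) (infnorm (transpose \<Theta> *v p - q) / f))"
  have g_le: "g (p, q) \<le> s \<longleftrightarrow> infnorm p \<le> s * t \<and> infnorm (transpose \<Theta> *v p - q) \<le> s * f" for p q s
    using tf by (simp add: g_def pos_divide_le_eq)
  have exF: "\<exists>z\<in>F. g z \<le> s" if s: "1 < s" "s \<le> 2" for s
  proof -
    obtain p q where pq: "dual_solution \<Theta> (s * t) (s * f) p q" using ex s by blast
    have "s * t \<le> 2 * t" "s * f \<le> 2 * f" using s tf by auto
    then have "(p, q) \<in> F" using pq by (auto simp: F_def dual_solution_def)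
    moreover have "g (p, q) \<le> s" using pq by (simp only: g_le) (simp add: dual_solution_def)
    ultimately show ?thesis by blast
  qed
  have F0: "F \<noteq> {}" using exF[of 2] by auto
  define z where "z = arg_min_on g F"
  have z: "z \<in> F" "\<And>y. y \<in> F \<Longrightarrow> g z \<le> g y"
    using arg_min_if_finite[OF fin F0, of g] unfolding z_def by (auto simp: not_less)
  have "g z \<le> 1"
  proof (rule ccontr)
    assume "\<not> g z \<le> 1"
    then obtain s where s: "1 < s" "s < min 2 (g z)" using dense[of 1 "min 2 (g z)"] by auto
    then obtain y where "y \<in> F" "g y \<le> s" using exF[of s] by auto
    then show False using z(2)[of y] s by linarith
  qed
  moreover obtain p q where "z = (p, q)" by fastforce
  ultimately have "dual_solution \<Theta> t f p q"
    using z(1) g_le[of p q 1] by (auto simp: F_def dual_solution_def)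
  then show ?thesis by blast
qed

lemma norm_le_of_components:
  fixes v :: "'a::euclidean_space"
  assumes "\<And>b. b \<in> Basis \<Longrightarrow> \<bar>v \<bullet> b\<bar> \<le> a"
  shows "(norm v)\<^sup>2 \<le> real DIM('a) * a\<^sup>2"
proof -
  have "(norm v)\<^sup>2 = (\<Sum>b\<in>Basis. (v \<bullet> b)\<^sup>2)"
    unfolding power2_norm_eq_inner by (subst euclidean_inner) (simp add: power2_eq_square)
  also have "\<dots> \<le> (\<Sum>b\<in>(Basis::'a set). a\<^sup>2)"
    by (intro sum_mono iffD1[OF abs_le_square_iff]) (use assms in force)
  finally show ?thesis by simp
qed

lemma dual_solution_two:
  fixes \<Theta> :: "real ^ 'm ^ 'n"
  assumes tf: "t > 0" "f > 0" and dim: "CARD('n) + CARD('m) \<ge> 3"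
    and xy: "integer_vector x" "integer_vector y" and xy': "integer_vector x'" "integer_vector y'"
    and nz: "x \<noteq> 0" and indep: "\<And>r. form_vector \<Theta> t f x' y' \<noteq> r *\<^sub>R form_vector \<Theta> t f x y"
    and d: "d = real (CARD('n) + CARD('m))" and c: "c = sqrt (2 * d * (d - 1))"
    and ab: "a > 0" "b > 0" "c * (a * b) \<le> t ^ CARD('n) * f ^ CARD('m)"
    and bound: "t * infnorm (\<Theta> *v x - y) \<le> a" "f * infnorm x \<le> a"
    and bound': "t * infnorm (\<Theta> *v x' - y') \<le> b" "f * infnorm x' \<le> b"
  shows "\<exists>p q. dual_solution \<Theta> t f p q"
proof -
  define v w where "v = form_vector \<Theta> t f x y" and "w = form_vector \<Theta> t f x' y'"
  have v0: "v \<noteq> 0" using nz tf by (auto simp: v_def form_vector_def zero_prod_def)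
  have nv: "(norm v)\<^sup>2 \<le> real DIM((real ^ 'n) \<times> (real ^ 'm)) * a\<^sup>2"
    by (rule norm_le_of_components) (use form_vector_bound[OF tf bound] in \<open>simp add: v_def\<close>)
  have nw: "(norm w)\<^sup>2 \<le> real DIM((real ^ 'n) \<times> (real ^ 'm)) * b\<^sup>2"
    by (rule norm_le_of_components) (use form_vector_bound[OF tf bound'] in \<open>simp add: w_def\<close>)
  have c': "c = sqrt (2 * real DIM((real ^ 'n) \<times> (real ^ 'm)) * (real DIM((real ^ 'n) \<times> (real ^ 'm)) - 1))"
    unfolding c d DIM_form ..
  have dim': "DIM((real ^ 'n) \<times> (real ^ 'm)) \<ge> 3" using dim by simp
  \<comment> \<open>The centre \<open>(r, s)\<close> of the dense square is arbitrary; only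
    differences of points over it are used.\<close>
  obtain N :: nat and r s where N: "N > 0" and
    big: "ennreal (1 / (c * a * b)) < of_nat N * (of_nat N *
       emeasure lborel {\<xi>\<in>half_cube. \<bar>\<xi> \<bullet> v - r\<bar> < 1 / (2 * real N) \<and> \<bar>\<xi> \<bullet> w - s\<bar> < 1 / (2 * real N)})"
    by (rule planar_density[OF dim' ab(1,2) nv nw c'])
  define A where "A = {\<xi>\<in>half_cube. \<bar>\<xi> \<bullet> v - r\<bar> < 1 / (2 * real N) \<and> \<bar>\<xi> \<bullet> w - s\<bar> < 1 / (2 * real N)}"
  have c0: "c > 0" using dim by (simp add: c d)
  have "1 / (t ^ CARD('n) * f ^ CARD('m)) \<le> 1 / (c * a * b)"
    using ab c0 by (intro divide_left_mono) (auto simp: mult.assoc tf)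
  then have C: "ennreal (1 / (t ^ CARD('n) * f ^ CARD('m))) < of_nat N * (of_nat N * emeasure lborel A)"
    using big unfolding A_def by (meson ennreal_leI le_less_trans)
  have "\<exists>x\<in>A. \<exists>y\<in>A. x \<noteq> y \<and> x - y \<in> dual_lattice \<Theta> t f"
  proof (rule lattice_difference_orthogonal2[OF blichfeldt_dual_lattice[OF tf] _ v0 _ _ _ N _ _ C])
    show "A \<in> sets borel" unfolding A_def by measurable
    show "\<bar>(x - y) \<bullet> v\<bar> < 1 / real N" "\<bar>(x - y) \<bullet> w\<bar> < 1 / real N" if "x \<in> A" "y \<in> A" for x y
      using that unfolding A_def inner_diff_left by (auto intro: abs_diff_less_of_half)
    show "k \<bullet> v \<in> \<int>" "k \<bullet> w \<in> \<int>" if "k \<in> dual_lattice \<Theta> t f" for k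
      unfolding v_def w_def
      using dual_lattice_form_vector_int[OF that xy tf] dual_lattice_form_vector_int[OF that xy' tf] .
    show "w \<noteq> r *\<^sub>R v" for r unfolding v_def w_def by (rule indep)
  qed
  then show ?thesis by (rule dual_solution_of_difference) (use tf in \<open>auto simp: A_def\<close>)
qed

section \<open>The transference theorem\<close>

lemma infnorm_attained: "\<exists>b\<in>Basis. infnorm (x :: 'a::euclidean_space) = \<bar>x \<bullet> b\<bar>"
proof -
  have "infnorm x \<in> (\<lambda>b. \<bar>x \<bullet> b\<bar>) ` Basis"
    unfolding infnorm_Max by (rule Max_in) auto
  then show ?thesis by auto
qed

lemma infnorm_integer_vector:
  assumes "integer_vector x"
  shows "\<exists>k::nat. infnorm x = real k"
proof -
  obtain b where b: "b \<in> Basis" "infnorm x = \<bar>x \<bullet> b\<bar>" using infnorm_attained by blast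
  then obtain i where "b = axis i 1" by (auto simp: Basis_vec_def)
  then have "infnorm x = \<bar>x $ i\<bar>" using b by (simp add: inner_axis)
  moreover have "x $ i \<in> \<int>" using assms by (simp add: integer_vector_def)
  ultimately have "infnorm x \<in> \<int>" by simp
  then obtain k where "infnorm x = of_int k" by (auto elim: Ints_cases)
  then have "infnorm x = real (nat k)" using infnorm_pos_le[of x] by simp
  then show ?thesis by blast
qed

lemma exists_integer_vector_near: "\<exists>y :: real ^ 'n. integer_vector y \<and> infnorm (v - y) \<le> 1"
proof (intro exI conjI)
  let ?y = "(\<chi> i. of_int \<lfloor>v $ i\<rfloor>) :: real ^ 'n"
  show "integer_vector ?y" by (simp add: integer_vector_def)
  have "\<bar>v $ i - of_int \<lfloor>v $ i\<rfloor>\<bar> \<le> 1" for i by linarith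
  then show "infnorm (v - ?y) \<le> 1" by (auto simp: infnorm_le_iff Basis_vec_def inner_axis)
qed

text \<open>\<open>x'\<close> is shortest among the pairs whose scaled error
  \<open>t * infnorm (\<Theta> *v x' - y')\<close> is at most \<open>f * infnorm x'\<close>. If it
  is longer than \<open>X\<close>, approximability at scales just below \<open>infnorm x'\<close>
  gives a shorter \<open>x\<close>, which must violate that inequality.\<close>

lemma best_approximation_pair:
  fixes \<Theta> :: "real ^ 'm ^ 'n"
  assumes tf: "t > 0" "f > 0"
    and \<psi>_inv: "bij_betw \<psi> {0<..} {0<..}" and \<psi>_decr: "strict_antimono_on {0<..} \<psi>"
    and approx: "\<And>s. s \<ge> S \<Longrightarrow> \<exists>(x :: real ^ 'm) (y :: real ^ 'n).
        integer_vector x \<and> integer_vector y \<and> 0 < infnorm x \<and> infnorm x \<le> s \<and> infnorm (\<Theta> *v x - y) \<le> \<psi> s"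
    and X: "X \<ge> S + 1" "X > 1"
  obtains x y where "integer_vector x" "integer_vector y" "x \<noteq> 0" "t * infnorm (\<Theta> *v x - y) \<le> f * infnorm x"
      "infnorm x \<le> X"
  | x y x' y' where "integer_vector x" "integer_vector y" "integer_vector x'" "integer_vector y'"
      "x \<noteq> 0" "x' \<noteq> 0" "f * infnorm x < t * infnorm (\<Theta> *v x - y)"
      "t * infnorm (\<Theta> *v x' - y') \<le> f * infnorm x'"
      "X < infnorm x'" "infnorm (\<Theta> *v x - y) \<le> \<psi> (infnorm x')"
proof -
  define good where "good = (\<lambda>(x :: real ^ 'm, y :: real ^ 'n). integer_vector x \<and> integer_vector y \<and> x \<noteq> 0 \<and>
    t * infnorm (\<Theta> *v x - y) \<le> f * infnorm x)"
  have anti: "\<psi> y < \<psi> x" if "0 < x" "x < y" for x y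
    using \<psi>_decr that by (auto simp: monotone_on_def)
  have "\<exists>z. good z"
  proof -
    obtain K :: nat where K: "max 1 (t / f) < real K" using reals_Archimedean2 by blast
    \<comment> \<open>A long vector suffices: rounding \<open>\<Theta> *v x\<close> leaves an error
      of at most 1.\<close>
    define x :: "real ^ 'm" where "x = (\<chi> i. real K)"
    obtain y where y: "integer_vector y" "infnorm (\<Theta> *v x - y) \<le> 1"
      using exists_integer_vector_near by blast
    have "real K \<le> infnorm x"
      using component_le_infnorm_cart[of x undefined] by (simp add: x_def)
    then have "t * infnorm (\<Theta> *v x - y) \<le> f * infnorm x"
    proof -
      have "t * infnorm (\<Theta> *v x - y) \<le> t" using y tf by simp
      also have "\<dots> \<le> f * real K" using K tf by (simp add: field_simps)
      also have "\<dots> \<le> f * infnorm x" using \<open>real K \<le> infnorm x\<close> tf by simp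
      finally show ?thesis .
    qed
    moreover have "x \<noteq> 0" using K by (auto simp: x_def vec_eq_iff)
    moreover have "integer_vector x" by (simp add: x_def integer_vector_def)
    ultimately have "good (x, y)" using y by (simp add: good_def)
    then show ?thesis by blast
  qed
  \<comment> \<open>Norms of integer vectors are natural numbers; the floor only makes the least
    number principle on \<open>nat\<close> applicable.\<close>
  then obtain z where z: "good z" and least: "\<And>z'. good z' \<Longrightarrow> nat \<lfloor>infnorm (fst z)\<rfloor> \<le> nat \<lfloor>infnorm (fst z')\<rfloor>"
    using ex_has_least_nat[of good _ "\<lambda>z. nat \<lfloor>infnorm (fst z)\<rfloor>"] by blast
  obtain x2 y2 where z_eq: "z = (x2, y2)" by fastforce
  have g2: "integer_vector x2" "integer_vector y2" "x2 \<noteq> 0" "t * infnorm (\<Theta> *v x2 - y2) \<le> f * infnorm x2"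
    using z by (auto simp: good_def z_eq)
  have least': "t * infnorm (\<Theta> *v x - y) > f * infnorm x"
    if xy: "integer_vector x" "integer_vector y" "x \<noteq> 0" "infnorm x < infnorm x2" for x y
  proof (rule ccontr)
    assume "\<not> ?thesis"
    then have "good (x, y)" using xy by (simp add: good_def)
    then have "nat \<lfloor>infnorm x2\<rfloor> \<le> nat \<lfloor>infnorm x\<rfloor>" using least z_eq by fastforce
    moreover obtain k l :: nat where "infnorm x = real k" "infnorm x2 = real l"
      using infnorm_integer_vector xy(1) g2(1) by blast
    ultimately show False using xy(4) by simp
  qed
  define X2 where "X2 = infnorm x2"
  show thesis
  proof (cases "X2 \<le> X")
    case True
    then show thesis using g2 that(1) by (auto simp: X2_def)
  next
    case False
    \<comment> \<open>The largest integer below \<open>X2\<close>: all integer vectors shorter than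
      \<open>x2\<close> have norm at most \<open>s0\<close>, so the finite set \<open>G\<close>
      serves every scale in \<open>[s0, X2)\<close>. The assumptions on \<open>X\<close> make
      \<open>s0\<close> positive and at least \<open>S\<close>.\<close>
    define s0 where "s0 = X2 - 1"
    have s0: "s0 > 0" "s0 \<ge> S" "s0 < X2" using False X by (auto simp: s0_def)
    define G where "G = {(x, y). integer_vector x \<and> integer_vector y \<and> infnorm x \<le> s0 \<and>
        infnorm (\<Theta> *v x - y) \<le> \<psi> s0} \<inter> {(x, y). x \<noteq> 0}"
    have fin: "finite G" unfolding G_def by (intro finite_Int disjI1 finite_integer_solutions)
    have exG: "\<exists>(x, y)\<in>G. infnorm (\<Theta> *v x - y) \<le> \<psi> s" if s: "s0 \<le> s" "s < X2" for s
    proof -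
      obtain x y where xy: "integer_vector x" "integer_vector y" "0 < infnorm x" "infnorm x \<le> s"
        "infnorm (\<Theta> *v x - y) \<le> \<psi> s"
        using approx[of s] s0(2) s(1) by auto
      obtain k l :: nat where kl: "infnorm x = real k" "X2 = real l"
        using infnorm_integer_vector xy(1) g2(1) unfolding X2_def by blast
      have "real k < real l" using xy(4) s kl by simp
      then have "infnorm x \<le> s0" by (simp add: s0_def kl)
      moreover have "\<psi> s \<le> \<psi> s0" using anti[of s0 s] s s0 by (cases "s = s0") auto
      ultimately have "(x, y) \<in> G" using xy by (auto simp: G_def infnorm_0)
      then show ?thesis using xy(5) by blast
    qed
    define g where "g = (\<lambda>(x, y). infnorm (\<Theta> *v x - y))"
    have G0: "G \<noteq> {}" using exG[of s0] s0 by auto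
    define z1 where "z1 = arg_min_on g G"
    have z1: "z1 \<in> G" "\<And>y. y \<in> G \<Longrightarrow> g z1 \<le> g y"
      using arg_min_if_finite[OF fin G0, of g] unfolding z1_def by (auto simp: not_less)
    obtain x1 y1 where z1_eq: "z1 = (x1, y1)" by fastforce
    have le: "infnorm (\<Theta> *v x1 - y1) \<le> \<psi> s" if s: "s0 \<le> s" "s < X2" for s
    proof -
      obtain x y where "(x, y) \<in> G" "infnorm (\<Theta> *v x - y) \<le> \<psi> s" using exG[OF s] by auto
      then show ?thesis using z1(2)[of "(x, y)"] by (simp add: g_def z1_eq)
    qed
    \<comment> \<open>The scale tends to \<open>X2\<close>. Surjectivity of \<open>\<psi>\<close>
      replaces continuity: a value \<open>r\<close> strictly above \<open>\<psi> X2\<close> is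
      attained before \<open>X2\<close>.\<close>
    have "infnorm (\<Theta> *v x1 - y1) \<le> \<psi> X2"
    proof (rule ccontr)
      assume "\<not> ?thesis"
      then obtain r where r: "\<psi> X2 < r" "r < infnorm (\<Theta> *v x1 - y1)" using dense not_le by metis
      have "\<psi> X2 > 0" using \<psi>_inv s0 by (auto simp: bij_betw_def)
      then have "r \<in> \<psi> ` {0<..}" using \<psi>_inv r by (simp add: bij_betw_def)
      then obtain s1 where s1: "s1 > 0" "\<psi> s1 = r" by auto
      have "s1 < X2" using anti[of X2 s1] r s1 s0 by (cases s1 X2 rule: linorder_cases) auto
      then have "infnorm (\<Theta> *v x1 - y1) \<le> \<psi> (max s0 s1)" using le s0 by auto
      also have "\<dots> \<le> \<psi> s1" using anti[of s1 "max s0 s1"] s1 by (cases "s0 \<le> s1") (auto simp: max_def)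
      finally show False using r s1 by simp
    qed
    moreover have "integer_vector x1" "integer_vector y1" "x1 \<noteq> 0" "infnorm x1 \<le> s0"
      using z1(1) by (auto simp: G_def z1_eq)
    moreover from this have "f * infnorm x1 < t * infnorm (\<Theta> *v x1 - y1)"
      using least' s0(3) by (simp add: X2_def)
    ultimately show thesis using that(2)[of x1 y1 x2 y2] g2 False by (auto simp: X2_def)
  qed
qed

lemma infnorm_one_dim:
  assumes "(UNIV :: 'n set) = {i}"
  shows "infnorm (x :: real ^ 'n) = \<bar>x $ i\<bar>"
proof -
  obtain b where b: "b \<in> Basis" "infnorm x = \<bar>x \<bullet> b\<bar>" using infnorm_attained by blast
  then obtain j where "b = axis j 1" by (auto simp: Basis_vec_def)
  moreover have "j = i" using assms by auto
  ultimately show ?thesis using b by (simp add: inner_axis)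
qed

text \<open>By \<open>u\<close> and \<open>u'\<close> the sup-norms of the two form vectors are
  \<open>a\<close> and \<open>b\<close>, attained in different blocks. Scaling preserves which block
  is larger, strictly for the first vector, so the vectors are independent.\<close>

lemma dual_solution_of_pair:
  fixes \<Theta> :: "real ^ 'm ^ 'n"
  assumes tf: "t > 0" "f > 0"
    and xy: "integer_vector x" "integer_vector y" and xy': "integer_vector x'" "integer_vector y'"
    and nz: "x \<noteq> 0" "x' \<noteq> 0"
    and u: "f * infnorm x < t * infnorm (\<Theta> *v x - y)"
    and u': "t * infnorm (\<Theta> *v x' - y') \<le> f * infnorm x'"
    and d: "d = real (CARD('n) + CARD('m))" and c: "c = sqrt (2 * d * (d - 1))"
    and small: "c * ((t * infnorm (\<Theta> *v x - y)) * (f * infnorm x')) \<le> t ^ CARD('n) * f ^ CARD('m)"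
  shows "\<exists>p q. dual_solution \<Theta> t f p q"
proof -
  define a b where "a = t * infnorm (\<Theta> *v x - y)" and "b = f * infnorm x'"
  have X: "infnorm x > 0" "infnorm x' > 0" using nz by (auto simp: infnorm_pos_lt)
  have a: "a > 0" using u tf X(1) unfolding a_def by (meson less_trans mult_pos_pos)
  have b: "b > 0" using tf X by (simp add: b_def)
  show ?thesis
  proof (cases "CARD('n) + CARD('m) \<ge> 3")
    case True
    show ?thesis
    proof (rule dual_solution_two[OF tf True xy xy' nz(1) _ d c a b])
      fix r
      show "form_vector \<Theta> t f x' y' \<noteq> r *\<^sub>R form_vector \<Theta> t f x y"
      proof
        assume eq: "form_vector \<Theta> t f x' y' = r *\<^sub>R form_vector \<Theta> t f x y"
        then have "t *\<^sub>R (\<Theta> *v x' - y') = t *\<^sub>R (r *\<^sub>R (\<Theta> *v x - y))" "f *\<^sub>R x' = f *\<^sub>R (r *\<^sub>R x)"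
          by (simp_all add: form_vector_def mult.commute)
        then have e: "\<Theta> *v x' - y' = r *\<^sub>R (\<Theta> *v x - y)" "x' = r *\<^sub>R x"
          using tf by (simp_all only: scaleR_cancel_left) auto
        have "r \<noteq> 0" using e(2) nz by auto
        have n: "infnorm (\<Theta> *v x' - y') = \<bar>r\<bar> * infnorm (\<Theta> *v x - y)" "infnorm x' = \<bar>r\<bar> * infnorm x"
          unfolding e(1) by (simp only: infnorm_mul, simp only: e(2) infnorm_mul)
        have "\<bar>r\<bar> * (t * infnorm (\<Theta> *v x - y)) \<le> \<bar>r\<bar> * (f * infnorm x)"
          using u' unfolding n by (simp add: mult.left_commute)
        then show False using u \<open>r \<noteq> 0\<close> by simp
      qed
    qed (use small u u' in \<open>auto simp: a_def b_def\<close>)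
  next
    case False
    have "CARD('n) > 0" "CARD('m) > 0" by auto
    then have card: "CARD('n) = 1" "CARD('m) = 1" using False by linarith+
    then obtain i j where i: "(UNIV :: 'n set) = {i}" and j: "(UNIV :: 'm set) = {j}"
      by (auto simp: card_1_singleton_iff)
    have mv: "(\<Theta> *v x) $ i = \<Theta> $ i $ j * x $ j" for x by (simp add: matrix_vector_mult_def j)
    \<comment> \<open>Integral determinant of the two pairs, nonzero by the same comparison of
      \<open>u\<close> and \<open>u'\<close>. Both products in \<open>t * f * K\<close> are bounded
      by \<open>a * b\<close>, one of them strictly, which contradicts \<open>small\<close> with
      \<open>c = 2\<close>.\<close>
    define K where "K = y' $ i * x $ j - y $ i * x' $ j"
    define v v' where "v = (\<Theta> *v x - y) $ i" and "v' = (\<Theta> *v x' - y') $ i"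
    have K: "K = v * x' $ j - v' * x $ j"
      by (simp add: K_def v_def v'_def mv algebra_simps)
    have "d = 2" using card by (simp add: d)
    then have "c = sqrt (2\<^sup>2)" unfolding c by simp
    then have c2: "c = 2" by (simp only: real_sqrt_abs abs_numeral)
    have nx: "infnorm x = \<bar>x $ j\<bar>" "infnorm x' = \<bar>x' $ j\<bar>" "infnorm (\<Theta> *v x - y) = \<bar>v\<bar>" "infnorm (\<Theta> *v x' - y') = \<bar>v'\<bar>"
      by (simp_all only: infnorm_one_dim[OF i] infnorm_one_dim[OF j] v_def v'_def)
    note u_nx = u[unfolded nx] and u'_nx = u'[unfolded nx] and X_nx = X[unfolded nx]
    have "K \<in> \<int>" using xy xy' by (auto simp: K_def integer_vector_def)
    have "K \<noteq> 0"
    proof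
      assume "K = 0"
      then have "\<bar>v\<bar> * \<bar>x' $ j\<bar> = \<bar>v'\<bar> * \<bar>x $ j\<bar>" using K by (simp add: abs_mult[symmetric])
      then have "(t * \<bar>v\<bar>) * \<bar>x' $ j\<bar> = (t * \<bar>v'\<bar>) * \<bar>x $ j\<bar>" by simp
      also have "\<dots> \<le> (f * \<bar>x' $ j\<bar>) * \<bar>x $ j\<bar>" using u'_nx by (intro mult_right_mono) auto
      finally have "(t * \<bar>v\<bar>) * \<bar>x' $ j\<bar> \<le> (f * \<bar>x $ j\<bar>) * \<bar>x' $ j\<bar>" by (simp add: mult_ac)
      then show False using u_nx X_nx by simp
    qed
    then have "1 \<le> \<bar>K\<bar>" using \<open>K \<in> \<int>\<close> Ints_nonzero_abs_ge1 by blast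
    also have "\<bar>K\<bar> \<le> \<bar>v\<bar> * \<bar>x' $ j\<bar> + \<bar>v'\<bar> * \<bar>x $ j\<bar>"
      unfolding K using abs_triangle_ineq4[of "v * x' $ j" "v' * x $ j"] by (simp add: abs_mult)
    finally have "t * f * 1 \<le> t * f * (\<bar>v\<bar> * \<bar>x' $ j\<bar> + \<bar>v'\<bar> * \<bar>x $ j\<bar>)"
      using tf by (intro mult_left_mono) auto
    also have "\<dots> = a * b + (t * \<bar>v'\<bar>) * (f * \<bar>x $ j\<bar>)"
      by (simp add: a_def b_def nx algebra_simps)
    also have "(t * \<bar>v'\<bar>) * (f * \<bar>x $ j\<bar>) \<le> b * (f * \<bar>x $ j\<bar>)"
      using u'_nx tf by (intro mult_right_mono) (auto simp: b_def nx)
    also have "b * (f * \<bar>x $ j\<bar>) < b * a" using u_nx b by (simp add: a_def nx)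
    finally have "t * f < 2 * (a * b)" by simp
    moreover have "2 * (a * b) \<le> t * f" using small card by (simp add: c2 a_def b_def)
    ultimately show ?thesis by linarith
  qed
qed

text \<open>The alternative may vary with \<open>t\<close>, while monotonicity is later used from a
  point unrelated to \<open>t\<close>. If \<open>h\<close> is eventually constant, both kinds hold
  from a common \<open>T\<close>; otherwise the kind valid from \<open>T0\<close> excludes the other
  for all later \<open>t\<close>.\<close>

lemma eventually_monotone_alternative:
  assumes "\<forall>\<^sub>F t in at_top. (antimono_on {t..} h \<and> P t) \<or> (mono_on {t..} h \<and> Q t)"
  obtains T :: real where
    "\<And>t. t \<ge> T \<Longrightarrow> (antimono_on {T..} h \<and> P t) \<or> (mono_on {T..} (h :: real \<Rightarrow> real) \<and> Q t)"
proof -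
  obtain T0 where T0: "\<And>t. t \<ge> T0 \<Longrightarrow> (antimono_on {t..} h \<and> P t) \<or> (mono_on {t..} h \<and> Q t)"
    using assms by (auto simp: eventually_at_top_linorder)
  have sub: "antimono_on {T..} h \<Longrightarrow> antimono_on {t..} h" "mono_on {T..} h \<Longrightarrow> mono_on {t..} h" if "T \<le> t" for T t
    using that by (auto intro: monotone_on_subset)
  show thesis
  proof (cases "\<exists>T\<ge>T0. antimono_on {T..} h \<and> mono_on {T..} h")
    case True
    then obtain T where "T \<ge> T0" "antimono_on {T..} h" "mono_on {T..} h" by blast
    then show thesis using T0 by (intro that[of T]) (meson order_trans)
  next
    case False
    then show thesis using T0 sub by (intro that[of T0]) (meson order_refl)
  qed
qed

theorem theorem5:
  fixes \<Theta> :: "real ^ 'm ^ 'n"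
    and \<phi> \<psi> :: "real \<Rightarrow> real"
    and n m d :: nat
    and c \<Delta> :: real
  assumes n: "n = CARD('n)"
    and m: "m = CARD('m)"
    and d: "d = n + m"
    and c: "c = sqrt (2 * real d * (real d - 1))"
    and \<Delta>: "\<Delta> = Delta TYPE('n + 'm)"
    and \<phi>_pos: "\<And>t. t > 0 \<Longrightarrow> \<phi> t > 0"
    and \<phi>_lim: "filterlim (\<lambda>t. t ^ n * \<phi> t ^ (m - 1)) at_top at_top"
    and \<psi>_inv: "bij_betw \<psi> {0<..} {0<..}"
    and \<psi>_decr: "strict_antimono_on {0<..} \<psi>"
    and cond: "\<forall>\<^sub>F t in at_top.
        (antimono_on {t..} (\<lambda>s. s * \<psi> s) \<and>
           \<psi> (\<Delta> * t ^ n * \<phi> t ^ (m - 1)) \<le> inverse (c * \<Delta> * t)) \<or>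
        (mono_on {t..} (\<lambda>s. s * \<psi> s) \<and>
           inv_into {0<..} \<psi> (\<Delta> * t ^ (n - 1) * \<phi> t ^ m) \<le> inverse (c * \<Delta> * \<phi> t))"
    and approx: "uniformly_approximable \<Theta> \<psi>"
  shows "uniformly_approximable (transpose \<Theta>) \<phi>"
proof -
  have \<Delta>0: "\<Delta> > 0" using Delta_slab(1)[of 2] by (simp add: \<Delta>)
  have nm: "n > 0" "m > 0" by (auto simp: n m)
  have d': "real d = real (CARD('n) + CARD('m))" by (simp add: d n m)
  have c0: "c > 0" using nm by (simp add: c d)
  obtain T where T: "\<And>t. t \<ge> T \<Longrightarrow>
      (antimono_on {T..} (\<lambda>s. s * \<psi> s) \<and>
         \<psi> (\<Delta> * t ^ n * \<phi> t ^ (m - 1)) \<le> inverse (c * \<Delta> * t)) \<or>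
      (mono_on {T..} (\<lambda>s. s * \<psi> s) \<and>
         inv_into {0<..} \<psi> (\<Delta> * t ^ (n - 1) * \<phi> t ^ m) \<le> inverse (c * \<Delta> * \<phi> t))"
    by (rule eventually_monotone_alternative[OF cond]) blast
  obtain S where S: "\<And>s. s \<ge> S \<Longrightarrow> \<exists>(x :: real ^ 'm) (y :: real ^ 'n).
        integer_vector x \<and> integer_vector y \<and> 0 < infnorm x \<and> infnorm x \<le> s \<and> infnorm (\<Theta> *v x - y) \<le> \<psi> s"
    using approx by (auto simp: uniformly_approximable_def eventually_at_top_linorder)
  have ev_X: "\<forall>\<^sub>F t in at_top. (max (max (S + 1) T) 2) / \<Delta> \<le> t ^ n * \<phi> t ^ (m - 1)"
    using \<phi>_lim by (simp add: filterlim_at_top)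
  have "\<forall>\<^sub>F t in at_top. \<exists>(p :: real ^ 'n) (q :: real ^ 'm).
        integer_vector p \<and> integer_vector q \<and>
        0 < infnorm p \<and> infnorm p \<le> t \<and> infnorm (transpose \<Theta> *v p - q) \<le> \<phi> t"
    using ev_X eventually_ge_at_top[of T] eventually_ge_at_top[of 1]
  proof eventually_elim
    case (elim t)
    define f where "f = \<phi> t"
    have tf: "t > 0" "f > 0" using elim \<phi>_pos by (auto simp: f_def)
    \<comment> \<open>\<open>X\<close> and \<open>U\<close> are the largest norm of \<open>x\<close>
      and the largest error for which a single approximation suffices; they are balanced by
      \<open>f * X = t * U\<close>.\<close>
    define X where "X = \<Delta> * t ^ n * f ^ (m - 1)"
    define U where "U = \<Delta> * t ^ (n - 1) * f ^ m"
    have "max (max (S + 1) T) 2 \<le> X"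
      using elim(1) \<Delta>0 by (simp add: X_def f_def pos_divide_le_eq mult_ac)
    then have X: "X \<ge> S + 1" "X \<ge> T" "X > 1" by auto
    have fX: "f * X = \<Delta> * (t ^ n * f ^ m)"
      using nm by (cases m) (auto simp: X_def mult_ac)
    have tU: "t * U = \<Delta> * (t ^ n * f ^ m)"
      using nm by (cases n) (auto simp: U_def mult_ac)
    have U0: "U > 0" using tf \<Delta>0 by (simp add: U_def)
    have anti: "\<psi> y < \<psi> x" if "0 < x" "x < y" for x y
      using \<psi>_decr that by (auto simp: monotone_on_def)
    have one: "\<exists>p q. dual_solution \<Theta> t f p q"
      if "integer_vector x" "integer_vector y" "x \<noteq> 0" "t * infnorm (\<Theta> *v x - y) \<le> f * X" "f * infnorm x \<le> f * X" for x y
      using dual_solution_one[OF tf that(1-3)] that(4,5) by (simp add: fX \<Delta> n m mult.assoc)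
    have sol: "\<exists>p q. dual_solution \<Theta> t f p q"
    proof (rule best_approximation_pair[OF tf \<psi>_inv \<psi>_decr S X(1,3)])
      fix x y assume xy: "integer_vector x" "integer_vector y" "x \<noteq> 0"
        "t * infnorm (\<Theta> *v x - y) \<le> f * infnorm x" "infnorm x \<le> X"
      then have "f * infnorm x \<le> f * X" using tf by simp
      then show ?thesis using one xy by force
    next
      fix x y x' y'
      assume xy: "integer_vector x" "integer_vector y" "integer_vector x'" "integer_vector y'"
        and nz: "x \<noteq> 0" "x' \<noteq> 0" and u: "f * infnorm x < t * infnorm (\<Theta> *v x - y)"
        and u': "t * infnorm (\<Theta> *v x' - y') \<le> f * infnorm x'"
        and X': "X < infnorm x'" and u\<psi>: "infnorm (\<Theta> *v x - y) \<le> \<psi> (infnorm x')"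
      define v where "v = infnorm (\<Theta> *v x - y)"
      define Z where "Z = infnorm x'"
      have Z: "Z > X" "Z > 0" using X' X by (auto simp: Z_def)
      have v0: "v > 0"
      proof -
        have "0 < t * v" using u tf nz infnorm_pos_lt[of x] unfolding v_def by (meson less_trans mult_pos_pos)
        then show ?thesis using tf by (simp add: zero_less_mult_iff)
      qed
      \<comment> \<open>The product \<open>v * Z\<close> is compared with values of
        \<open>s * \<psi> s\<close>: in case (i) at \<open>Z\<close> and then at the smaller
        \<open>X\<close>, in case (ii) at the preimages of \<open>v\<close> and then of
        \<open>U\<close>.\<close>
      have "c * ((t * v) * (f * Z)) \<le> t ^ n * f ^ m" if "\<not> v \<le> U"
        using T[OF elim(2)]
      proof (elim disjE conjE)
        assume mono: "antimono_on {T..} (\<lambda>s. s * \<psi> s)"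
          and le: "\<psi> (\<Delta> * t ^ n * \<phi> t ^ (m - 1)) \<le> inverse (c * \<Delta> * t)"
        have "v * Z \<le> Z * \<psi> Z" using u\<psi> Z by (simp add: v_def Z_def mult.commute)
        also have "\<dots> \<le> X * \<psi> X" using mono X Z by (auto simp: monotone_on_def)
        also have "\<dots> \<le> X * inverse (c * \<Delta> * t)"
          using le X by (intro mult_left_mono) (auto simp: X_def f_def)
        finally have "(c * t * f) * (v * Z) \<le> (c * t * f) * (X * inverse (c * \<Delta> * t))"
          using c0 tf by (intro mult_left_mono) auto
        also have "\<dots> = f * X / \<Delta>" using c0 tf \<Delta>0 by (simp add: field_simps)
        also have "\<dots> = t ^ n * f ^ m" using \<Delta>0 by (simp add: fX)
        finally show ?thesis by (simp add: mult_ac)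
      next
        assume mono: "mono_on {T..} (\<lambda>s. s * \<psi> s)"
          and le: "inv_into {0<..} \<psi> (\<Delta> * t ^ (n - 1) * \<phi> t ^ m) \<le> inverse (c * \<Delta> * \<phi> t)"
        \<comment> \<open>With \<open>\<psi> s1 = v\<close>, the bound
          \<open>v \<le> \<psi> Z\<close> gives \<open>Z \<le> s1\<close>, and \<open>v > U\<close>
          gives \<open>s1 < s0\<close>; all three lie in the range where \<open>s * \<psi> s\<close>
          is non-decreasing.\<close>
        define s0 where "s0 = inv_into {0<..} \<psi> U"
        have img: "\<psi> ` {0<..} = {0<..}" using \<psi>_inv by (simp add: bij_betw_def)
        have s0: "s0 > 0" "\<psi> s0 = U"
          using U0 img inv_into_into[of U \<psi> "{0<..}"] f_inv_into_f[of U \<psi> "{0<..}"] by (auto simp: s0_def)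
        have "v \<in> \<psi> ` {0<..}" using v0 img by simp
        then obtain s1 where s1: "s1 > 0" "\<psi> s1 = v" by auto
        have "s1 < s0" using anti[of s0 s1] s0 s1 that by (cases s1 s0 rule: linorder_cases) auto
        have "Z \<le> s1"
          using anti[of s1 Z] s1 u\<psi> by (cases "Z \<le> s1") (auto simp: v_def Z_def)
        have "v * Z \<le> s1 * \<psi> s1" using \<open>Z \<le> s1\<close> v0 s1 by (simp add: mult.commute)
        also have "\<dots> \<le> s0 * \<psi> s0"
          using mono \<open>Z \<le> s1\<close> \<open>s1 < s0\<close> Z X by (auto simp: monotone_on_def)
        also have "\<dots> \<le> inverse (c * \<Delta> * f) * U"
          using le U0 unfolding s0(2) by (intro mult_right_mono) (auto simp: s0_def U_def f_def)
        finally have "(c * t * f) * (v * Z) \<le> (c * t * f) * (inverse (c * \<Delta> * f) * U)"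
          using c0 tf by (intro mult_left_mono) auto
        also have "\<dots> = t * U / \<Delta>" using c0 tf \<Delta>0 by (simp add: field_simps)
        also have "\<dots> = t ^ n * f ^ m" using \<Delta>0 by (simp add: tU)
        finally show ?thesis by (simp add: mult_ac)
      qed
      \<comment> \<open>Here \<open>x\<close> alone suffices: by \<open>u\<close>, its larger block
        is the error, bounded by \<open>t * U = f * X\<close>.\<close>
      moreover have ?thesis if "v \<le> U"
      proof (rule one[OF xy(1,2) nz(1)])
        have "t * v \<le> t * U" using that tf by simp
        then show "t * infnorm (\<Theta> *v x - y) \<le> f * X" "f * infnorm x \<le> f * X"
          using u by (auto simp: v_def fX tU)
      qed
      ultimately show ?thesis
        using dual_solution_of_pair[OF tf xy nz u u' d' c] by (auto simp: v_def Z_def n m)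
    qed
    show ?case
    \<comment> \<open>For \<open>f \<ge> 1\<close> a unit vector and rounding solve the dual system
      outright. For \<open>f < 1\<close>, a solution with \<open>p = 0\<close> would have an integer
      vector \<open>q\<close> of norm below 1, so \<open>q = 0\<close> as well.\<close>
    proof (cases "f \<ge> 1")
      case True
      obtain i :: 'n where True by blast
      define p :: "real ^ 'n" where "p = axis i 1"
      obtain q where q: "integer_vector q" "infnorm (transpose \<Theta> *v p - q) \<le> 1"
        using exists_integer_vector_near by blast
      have "integer_vector p" by (simp add: p_def integer_vector_def axis_def)
      moreover have "infnorm p = 1"
      proof (rule antisym)
        show "infnorm p \<le> 1" by (auto simp: infnorm_le_iff p_def Basis_vec_def inner_axis_axis)
        show "1 \<le> infnorm p" using component_le_infnorm_cart[of p i] by (simp add: p_def)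
      qed
      ultimately show ?thesis using q True elim(3) by (intro exI[of _ p] exI[of _ q]) (auto simp: f_def)
    next
      case False
      obtain p q where pq: "dual_solution \<Theta> t f p q" using sol by blast
      have "p \<noteq> 0"
      proof
        assume p: "p = 0"
        then have "infnorm q < 1" using pq False by (simp add: dual_solution_def infnorm_neg)
        moreover obtain k :: nat where "infnorm q = real k"
          using pq infnorm_integer_vector by (auto simp: dual_solution_def)
        ultimately have "q = 0" by (simp add: infnorm_eq_0)
        then show False using pq p by (simp add: dual_solution_def)
      qed
      then show ?thesis using pq
        by (intro exI[of _ p] exI[of _ q]) (auto simp: dual_solution_def f_def infnorm_pos_lt)
    qed
  qed
  then show ?thesis by (simp add: uniformly_approximable_def)
qed

end
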